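(* Let $A=(q,q^4;q^5)_\infty$, $B=(q^2,q^3;q^5)_\infty$, $E_1=(q;q)_\infty$, $E_5=(q^5;q^5)_\infty$ and $S=\sum_{n=-\infty}^{\infty}(-1)^n n\, q^{n(5n+1)/2}$. Then \begin{align*} &\sum_{n\geq0}\big[NB_{3}(1,5,5n)-NB_{3}(4,5,5n)+2NB_{3}(2,5,5n)-2NB_{3}(3,5,5n)\big]q^n\\ &=\frac{B\,E_5}{2A^3}-\frac{B\,E_5^2}{2E_1^5A^3}-5\frac{B\,E_5^2}{E_1^6A^2}\,S+\frac{15q\,B\,E_5^7}{2E_1^6A^3}\Big(4+3q\frac{A^5}{B^5}\Big)-\frac{5q\,E_5^5}{2E_1^6B}. \end{align*}
   Context: Notation: $(a;q)_\infty=\prod_{n\ge0}(1-aq^n)$ and $(a_1,\dots,a_t;q)_\infty=(a_1;q)_\infty\cdots(a_t;q)_\infty$; identities are of formal power series in $q$ (equivalently analytic for $|q|<1$). For $k\ge2$, a $k$-colored partition of $n\ge0$ is a $k$-tuple $\pi=(\pi^{(1)},\dots,\pi^{(k)})$ of ordinary partitions with $|\pi^{(1)}|+\cdots+|\pi^{(k)}|=n$ (written $\pi\vdash n$); $\#(\pi^{(i)})$ is the number of parts of $\pi^{(i)}$, and $\mathrm{crank}_k(\pi)=\#(\pi^{(1)})-\#(\pi^{(2)})$. For $k\ge2$, $j\ge2$, $0\le m\le j-1$, $n\ge0$, $$NB_k(m,j,n)=\sum_{\pi\vdash n,\ \mathrm{crank}_k(\pi)\equiv m \pmod j}\#(\pi^{(1)}).$$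 *)

theory Defs
  imports "HOL-Analysis.Analysis" "HOL-Number_Theory.Cong" "HOL-Library.Multiset"
begin

definition qpoch_inf :: "'a \<Rightarrow> 'a \<Rightarrow> 'a :: {t2_space, comm_ring_1}" where
  "qpoch_inf a q = (\<Prod>n. 1 - a * q ^ n)"

definition qpoch_infs :: "'a list \<Rightarrow> 'a \<Rightarrow> 'a :: {t2_space, comm_ring_1}" where
  "qpoch_infs as q = (\<Prod>a\<leftarrow>as. qpoch_inf a q)"

(* Over formal power series, prodinf and infsum refer to the X-adic topology. *)

lemma convergent_prod_qpoch_fps:
  fixes r s :: nat
  assumes "r > 0" "s > 0"
  shows "convergent_prod (\<lambda>n. 1 - fps_X ^ r * (fps_X ^ s) ^ n :: complex fps)"
proof -
  define P where "P = (\<lambda>N. \<Prod>i\<le>N. 1 - fps_X ^ r * (fps_X ^ s) ^ i :: complex fps)"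
  define L where "L = Abs_fps (\<lambda>m. fps_nth (P m) m)"
  have step: "fps_nth (P (Suc N)) m = fps_nth (P N) m" if "m \<le> N" for N m
  proof -
    have "N \<le> s * N"
      using assms by simp
    then have less: "m < r + s * Suc N"
      using that assms unfolding mult_Suc_right by linarith
    have "P (Suc N) = P N - fps_X ^ (r + s * Suc N) * P N"
      by (simp only: P_def prod.atMost_Suc power_add power_mult) (simp add: algebra_simps)
    with less show ?thesis
      by (simp only: fps_sub_nth fps_X_power_mult_nth) simp
  qed
  have stable: "fps_nth (P N) m = fps_nth L m" if "m \<le> N" for N m
    using that by (induction N rule: dec_induct) (simp_all add: L_def step)
  have "P \<longlonglongrightarrow> L"
    by (rule tendsto_fpsI) (use stable in \<open>auto simp: eventually_sequentially\<close>)
  moreover have "fps_nth L 0 = 1"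
    using assms by (simp add: L_def P_def)
  then have "L \<noteq> 0"
    by auto
  ultimately show ?thesis
    unfolding convergent_prod_def raw_has_prod_def P_def by (intro exI[of _ 0] exI[of _ L]) simp
qed

lemma summable_on_weighted_theta_fps:
  "(\<lambda>n::int. (-1) powi n * of_int n * fps_X ^ nat (n * (5 * n + 1) div 2) :: complex fps)
     summable_on UNIV"
proof -
  define f where
    "f = (\<lambda>n::int. (-1) powi n * of_int n * fps_X ^ nat (n * (5 * n + 1) div 2) :: complex fps)"
  have f_zero: "fps_nth (f n) m = 0" if "n \<notin> {- int m..int m}" for n m
  proof -
    have "\<bar>n\<bar> * 2 \<le> \<bar>n\<bar> * \<bar>5 * n + 1\<bar>"
    proof (cases "n = 0")
      case False
      then show ?thesis by (intro mult_left_mono) linarith+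
    qed simp
    also have "\<dots> = n * (5 * n + 1)"
      by (auto simp: abs_if zero_less_mult_iff algebra_simps)
    finally have "2 * \<bar>n\<bar> \<le> n * (5 * n + 1)"
      by simp
    then have "\<bar>n\<bar> \<le> n * (5 * n + 1) div 2"
      by linarith
    with that have "m < nat (n * (5 * n + 1) div 2)"
      by auto
    then show ?thesis
      unfolding f_def by (simp only: fps_X_power_mult_right_nth) simp
  qed
  have "finite {n \<in> UNIV. fps_nth (f n) m \<noteq> 0}" for m
    by (rule finite_subset[of _ "{- int m..int m}"]) (use f_zero in blast, simp)
  then have "(f has_sum Abs_fps (\<lambda>m. \<Sum>n | n \<in> UNIV \<and> fps_nth (f n) m \<noteq> 0. fps_nth (f n) m)) UNIV"
    by (rule has_sum_fpsI) simp
  then show ?thesis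
    unfolding summable_on_def f_def by blast
qed

definition is_partition :: "nat multiset \<Rightarrow> bool" where
  "is_partition p \<longleftrightarrow> 0 \<notin># p"

definition colored_partitions :: "nat \<Rightarrow> nat \<Rightarrow> nat multiset list set" where
  "colored_partitions k n =
     {ps. length ps = k \<and> (\<forall>p\<in>set ps. is_partition p) \<and> (\<Sum>p\<leftarrow>ps. \<Sum>\<^sub># p) = n}"

lemma finite_colored_partitions: "finite (colored_partitions k n)"
proof -
  define C where "C = {p. set_mset p \<subseteq> {..n} \<and> size p \<le> n}"
  have "C \<subseteq> mset ` {xs. set xs \<subseteq> {..n} \<and> length xs \<le> n}"
  proof
    fix p assume "p \<in> C"
    then show "p \<in> mset ` {xs. set xs \<subseteq> {..n} \<and> length xs \<le> n}"
      unfolding C_def by (cases p rule: ex_mset[THEN exE]) auto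
  qed
  then have "finite C"
    by (rule finite_subset) (intro finite_imageI finite_lists_length_le, simp)
  have size_le: "size p \<le> \<Sum>\<^sub># p" if "0 \<notin># p" for p :: "nat multiset"
    using that by (induction p) auto
  have "p \<in> C" if "ps \<in> colored_partitions k n" "p \<in> set ps" for p ps
  proof -
    have p: "\<Sum>\<^sub># p \<le> n" "0 \<notin># p"
      using that member_le_sum_list[of "\<Sum>\<^sub># p" "map sum_mset ps"]
      by (auto simp: colored_partitions_def is_partition_def)
    moreover have "x \<le> \<Sum>\<^sub># p" if "x \<in># p" for x
      using that by (metis le_add1 multi_member_split sum_mset.add_mset)
    ultimately show ?thesis
      using size_le[of p] by (fastforce simp: C_def)
  qed
  then have "colored_partitions k n \<subseteq> {ps. set ps \<subseteq> C \<and> length ps = k}"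
    by (auto simp: colored_partitions_def)
  then show ?thesis
    using finite_lists_length_eq[OF \<open>finite C\<close>] by (rule finite_subset)
qed

(* The components pi^(1) and pi^(2) are the list entries at positions 0 and 1;
   the crank is only meaningful for k >= 2. *)
definition crank :: "nat multiset list \<Rightarrow> int" where
  "crank ps = int (size (ps ! 0)) - int (size (ps ! 1))"

definition NB :: "nat \<Rightarrow> nat \<Rightarrow> nat \<Rightarrow> nat \<Rightarrow> nat" where
  "NB k m j n = (\<Sum>ps | ps \<in> colored_partitions k n \<and> [crank ps = int m] (mod int j). size (ps ! 0))"

end

theory Submission
  imports Defs "HOL-Computational_Algebra.Fundamental_Theorem_Algebra"
begin

text \<open>
  The involution exchanging the first two components makes twice the left-hand side the sum of
  crank(pi) chi(crank(pi)), where chi is the odd function mod 5 with values 0, 1, 2, -2, -1. Expanding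
  chi in fifth roots of unity z reduces everything to F'(z) for F(z) the generating function of
  z^crank(pi), and F(z) T(z) = 1 with T(z) = (q, zq, q/z; q)_inf, so F'(z) = -T'(z)/T(z)^2.

  By the Jacobi triple product, splitting the exponents mod 5 gives T(z) = b(q^5) + kappa q a(q^5) with
  a = A E5, b = B E5 and kappa = z^2 + z^3; T'(z) similarly involves a, b and their weighted analogues
  a', b' = S. Two product formulas eliminate a' and b'. Multiplying T(z) and T(z^2) gives
  E1(q) E1(q^5) = b^2 - q a b - q^2 a^2, all thetas taken at q^5; its cube, compared mod 5 with Jacobi's
  series for E1^3 = T(1), expresses a' E1^3 and b' E1^3 by a, b and E1. Its norm under q -> wq (w^5 = 1) is
  E1^11 / E5 = b^10 - 11 q a^5 b^5 - q^2 a^10. Since 1/T(z) has denominator b^5 + kappa^5 q a^5 at q^5,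
  the terms of F'(z) with exponent divisible by 5 can be read off, and summing over z is finite algebra.
\<close>

section \<open>Power series congruences and weighted sums\<close>

text \<open>The arithmetic of kappa makes the plan work. It takes only two values, the roots of x^2
  + x - 1: one for z and 1/z, one for z^2 and z^3. So only two denominators M(kappa) = b^5 + kappa^5
  q a^5 occur, and their product N is exactly the norm form b^10 - 11 q a^5 b^5 - q^2 a^10. The sum
  over z has denominator N^2 at first; one N cancels in \<open>psi_pair\<close>, and the other
  equals E1^11 / E5, which explains the pure products in the denominators of the claim. The series
  a' has no counterpart in the claim, and b' enters only as S. Both are eliminated, and so is the S
  of the claim, so that in the end two polynomials in p = b^5, r = q a^5 and e = E1^3 are compared.
  Power series do not form a field, and z itself must be allowed to be a power series. Hence 1/z is
  passed as a separate argument, identities are stated with denominators multiplied out, and the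
  final cancellations rest on nonzero constant terms. Limits are handled by congruences modulo
  X^N.\<close>

lemma fps_X_power_dvd_iff:
  fixes f :: "'a::comm_ring_1 fps"
  shows "fps_X ^ N dvd f \<longleftrightarrow> (\<forall>m<N. fps_nth f m = 0)"
proof
  assume "fps_X ^ N dvd f"
  then show "\<forall>m<N. fps_nth f m = 0"
    by (auto simp: dvd_def fps_X_power_mult_nth)
next
  assume *: "\<forall>m<N. fps_nth f m = 0"
  have "f = fps_X ^ N * Abs_fps (\<lambda>m. fps_nth f (m + N))"
    using * by (auto simp: fps_eq_iff fps_X_power_mult_nth)
  then show "fps_X ^ N dvd f"
    by (rule dvdI)
qed

definition fps_cong :: "nat \<Rightarrow> 'a::comm_ring_1 fps \<Rightarrow> 'a fps \<Rightarrow> bool" where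
  "fps_cong N f g \<longleftrightarrow> fps_X ^ N dvd f - g"

lemma fps_cong_iff: "fps_cong N f g \<longleftrightarrow> (\<forall>m<N. fps_nth f m = fps_nth g m)"
  by (simp add: fps_cong_def fps_X_power_dvd_iff)

lemma fps_cong_refl [simp]: "fps_cong N f f"
  by (simp add: fps_cong_iff)

lemma fps_cong_sym: "fps_cong N f g \<Longrightarrow> fps_cong N g f"
  by (simp add: fps_cong_iff)

lemma fps_cong_trans [trans]: "fps_cong N f g \<Longrightarrow> fps_cong N g h \<Longrightarrow> fps_cong N f h"
  by (simp add: fps_cong_iff)

lemma fps_cong_mono: "fps_cong N f g \<Longrightarrow> M \<le> N \<Longrightarrow> fps_cong M f g"
  by (auto simp: fps_cong_iff)

lemma fps_cong_mult: "fps_cong N f g \<Longrightarrow> fps_cong N f' g' \<Longrightarrow> fps_cong N (f * f') (g * g')"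
proof -
  assume "fps_cong N f g" "fps_cong N f' g'"
  then have "fps_X ^ N dvd (f - g) * f' + g * (f' - g')"
    unfolding fps_cong_def by (intro dvd_add dvd_mult2 dvd_mult)
  then show ?thesis
    by (simp add: fps_cong_def algebra_simps)
qed

lemma fps_cong_sum: "(\<And>i. i \<in> I \<Longrightarrow> fps_cong N (f i) (g i)) \<Longrightarrow> fps_cong N (sum f I) (sum g I)"
  by (simp add: fps_cong_iff fps_sum_nth)

lemma fps_cong_prod: "(\<And>i. i \<in> I \<Longrightarrow> fps_cong N (f i) (g i)) \<Longrightarrow> fps_cong N (prod f I) (prod g I)"
  by (induction I rule: infinite_finite_induct) (simp_all add: fps_cong_mult)

lemma fps_eqI_cong: "(\<And>N. fps_cong N f g) \<Longrightarrow> f = g"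
  by (metis fps_cong_iff fps_ext lessI)

lemma fps_cong_1_minus: "fps_X ^ N dvd f \<Longrightarrow> fps_cong N (1 - f) 1"
  by (simp add: fps_cong_def)

section \<open>q-Pochhammer products and their truncations\<close>

definition qpoch :: "'a::comm_ring_1 \<Rightarrow> 'a \<Rightarrow> nat \<Rightarrow> 'a" where
  "qpoch a q N = (\<Prod>i<N. 1 - a * q ^ i)"

lemma fps_X_power_dvd_aq:
  fixes a q :: "'a::comm_ring_1 fps"
  assumes "fps_X dvd q" "N \<le> i"
  shows "fps_X ^ N dvd a * q ^ i"
  using assms by (meson dvd_mult dvd_power_same dvd_trans le_imp_power_dvd)

lemma qpoch_cong_Suc:
  fixes a q :: "'a::comm_ring_1 fps"
  assumes "fps_X dvd q" "N \<le> M"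
  shows "fps_cong N (qpoch a q M) (qpoch a q N)"
  using assms(2)
proof (induction M rule: dec_induct)
  case (step M)
  have "fps_cong N (qpoch a q M * (1 - a * q ^ M)) (qpoch a q N * 1)"
    using step assms by (intro fps_cong_mult fps_cong_1_minus fps_X_power_dvd_aq) auto
  then show ?case by (simp add: qpoch_def)
qed simp

text \<open>Bridge from the limit behind \<open>qpoch_inf\<close> to finite products; later
  arguments about infinite products go through this congruence. Divisibility of \<open>a\<close> by
  X gives every partial product constant term 1, and \<open>raw_has_prod\<close> demands a nonzero
  limit.\<close>

lemma qpoch_inf_cong:
  fixes a q :: "'a::idom fps"
  assumes q: "fps_X dvd q" and a: "fps_X dvd a" and "N \<le> M"
  shows "fps_cong N (qpoch_inf a q) (qpoch a q M)"
proof -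
  \<comment> \<open>Coefficient m is stable once m + 1 factors are present, so the limit is read off
    along the diagonal.\<close>
  define L where "L = Abs_fps (\<lambda>m. fps_nth (qpoch a q (Suc m)) m)"
  have L: "fps_nth (qpoch a q M) m = fps_nth L m" if "m < M" for m M
    using qpoch_cong_Suc[OF q, of "Suc m" M a] that by (simp add: L_def fps_cong_iff)
  have "(\<lambda>n. \<Prod>i\<le>n. 1 - a * q ^ i) \<longlonglongrightarrow> L"
  proof (rule tendsto_fpsI)
    fix m
    have "fps_nth (\<Prod>i\<le>n. 1 - a * q ^ i) m = fps_nth L m" if "m \<le> n" for n
      using L[of m "Suc n"] that by (simp add: qpoch_def lessThan_Suc_atMost)
    then show "\<forall>\<^sub>F n in sequentially. fps_nth (\<Prod>i\<le>n. 1 - a * q ^ i) m = fps_nth L m"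
      by (auto simp: eventually_sequentially)
  qed
  moreover have "fps_nth a 0 = 0"
    using a by (metis fps_X_power_dvd_iff power_one_right less_one)
  then have "fps_nth L 0 = 1"
    by (simp add: L_def qpoch_def)
  then have "L \<noteq> 0"
    by auto
  ultimately have "raw_has_prod (\<lambda>n. 1 - a * q ^ n) 0 L"
    by (simp add: raw_has_prod_def)
  then have "(\<lambda>n. 1 - a * q ^ n) has_prod L"
    by (simp add: has_prod_def)
  then have "qpoch_inf a q = L"
    unfolding qpoch_inf_def by (rule has_prod_unique[symmetric])
  then show ?thesis
    using L \<open>N \<le> M\<close> by (simp add: fps_cong_iff)
qed

text \<open>Coefficientwise, so that no convergence is involved. An infinite fibre would contribute
  0 by the convention for \<open>sum\<close>; therefore splitting and multiplying such series
  requires \<open>fin_fibres\<close>.\<close>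

definition wsum :: "'i set \<Rightarrow> ('i \<Rightarrow> 'a::comm_ring_1) \<Rightarrow> ('i \<Rightarrow> nat) \<Rightarrow> 'a fps" where
  "wsum I w e = Abs_fps (\<lambda>m. \<Sum>i | i \<in> I \<and> e i = m. w i)"

definition fin_fibres :: "'i set \<Rightarrow> ('i \<Rightarrow> nat) \<Rightarrow> bool" where
  "fin_fibres I e \<longleftrightarrow> (\<forall>m. finite {i \<in> I. e i = m})"

lemma wsum_nth: "fps_nth (wsum I w e) m = (\<Sum>i | i \<in> I \<and> e i = m. w i)"
  by (simp add: wsum_def)

lemma wsum_cong:
  "(\<And>i. i \<in> I \<Longrightarrow> w i = w' i) \<Longrightarrow> (\<And>i. i \<in> I \<Longrightarrow> e i = e' i) \<Longrightarrow> wsum I w e = wsum I w' e'"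
  unfolding fps_eq_iff wsum_nth by (intro allI sum.cong) auto

lemma wsum_finite: "finite I \<Longrightarrow> wsum I w e = (\<Sum>i\<in>I. fps_const (w i) * fps_X ^ e i)"
  by (auto simp: fps_eq_iff wsum_nth fps_sum_nth sum.inter_filter intro!: sum.cong)

lemma wsum_trunc:
  assumes "\<And>i. i \<in> I \<Longrightarrow> i \<notin> J \<Longrightarrow> N \<le> e i" "J \<subseteq> I"
  shows "fps_cong N (wsum I w e) (wsum J w e)"
proof -
  have "{i \<in> I. e i = m} = {i \<in> J. e i = m}" if "m < N" for m
    using assms that by fastforce
  then show ?thesis
    by (simp add: fps_cong_iff wsum_nth)
qed

lemma wsum_add: "wsum I (\<lambda>i. w i + w' i) e = wsum I w e + wsum I w' e"
  by (simp add: fps_eq_iff wsum_nth sum.distrib)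

lemma wsum_cmult: "wsum I (\<lambda>i. c * w i) e = fps_const c * wsum I w e"
  by (simp add: fps_eq_iff wsum_nth sum_distrib_left)

lemma wsum_shift: "wsum I w (\<lambda>i. c + e i) = fps_X ^ c * wsum I w e"
proof -
  have "(\<Sum>i | i \<in> I \<and> c + e i = m. w i) = (if m < c then 0 else \<Sum>i | i \<in> I \<and> e i = m - c. w i)" for m
    by (auto intro!: sum.cong sum.neutral)
  then show ?thesis
    by (simp add: fps_eq_iff wsum_nth fps_X_power_mult_nth)
qed

lemma wsum_reindex:
  assumes "bij_betw f J I"
  shows "wsum I w e = wsum J (w \<circ> f) (e \<circ> f)"
  unfolding fps_eq_iff wsum_nth
proof
  fix m
  have "bij_betw f {j \<in> J. e (f j) = m} {i \<in> I. e i = m}"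
    using assms by (auto simp: bij_betw_def inj_on_def)
  then have "(\<Sum>j | j \<in> J \<and> e (f j) = m. w (f j)) = (\<Sum>i | i \<in> I \<and> e i = m. w i)"
    by (rule sum.reindex_bij_betw)
  then show "(\<Sum>i | i \<in> I \<and> e i = m. w i) = (\<Sum>j | j \<in> J \<and> (e \<circ> f) j = m. (w \<circ> f) j)"
    by simp
qed

lemma wsum_Un:
  assumes "fin_fibres (I \<union> J) e" "I \<inter> J = {}"
  shows "wsum (I \<union> J) w e = wsum I w e + wsum J w e"
proof -
  have "(\<Sum>i | i \<in> I \<union> J \<and> e i = m. w i)
      = (\<Sum>i | i \<in> I \<and> e i = m. w i) + (\<Sum>i | i \<in> J \<and> e i = m. w i)" for m
  proof -
    have "{i. i \<in> I \<union> J \<and> e i = m} = {i \<in> I. e i = m} \<union> {i \<in> J. e i = m}" by auto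
    moreover have "finite ({i \<in> I. e i = m} \<union> {i \<in> J. e i = m})"
      using assms(1) unfolding fin_fibres_def calculation[symmetric] by auto
    ultimately show ?thesis
      using assms(2) by (simp only:) (intro sum.union_disjoint, auto)
  qed
  then show ?thesis by (simp add: fps_eq_iff wsum_nth)
qed

lemma wsum_mult:
  assumes "fin_fibres I e" "fin_fibres J d"
  shows "wsum I w e * wsum J v d = wsum (I \<times> J) (\<lambda>(i, j). w i * v j) (\<lambda>(i, j). e i + d j)"
  unfolding fps_eq_iff
proof
  fix m
  have fin: "finite {i \<in> I. e i = k}" "finite {j \<in> J. d j = k}" for k
    using assms by (auto simp: fin_fibres_def)
  have "fps_nth (wsum I w e * wsum J v d) m
      = (\<Sum>k=0..m. \<Sum>(i,j) \<in> {i \<in> I. e i = k} \<times> {j \<in> J. d j = m - k}. w i * v j)"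
    by (simp add: fps_mult_nth wsum_nth sum_product sum.cartesian_product)
  also have "\<dots> = (\<Sum>(i,j) \<in> (\<Union>k\<in>{0..m}. {i \<in> I. e i = k} \<times> {j \<in> J. d j = m - k}). w i * v j)"
    by (rule sum.UNION_disjoint[symmetric]) (use fin in auto)
  also have "(\<Union>k\<in>{0..m}. {i \<in> I. e i = k} \<times> {j \<in> J. d j = m - k})
      = {ij \<in> I \<times> J. (case ij of (i, j) \<Rightarrow> e i + d j) = m}"
    by auto
  finally show "fps_nth (wsum I w e * wsum J v d) m
      = fps_nth (wsum (I \<times> J) (\<lambda>(i, j). w i * v j) (\<lambda>(i, j). e i + d j)) m"
    by (simp add: wsum_nth)
qed

lemma fin_fibres_Times:
  assumes "fin_fibres I e" "fin_fibres J d"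
  shows "fin_fibres (I \<times> J) (\<lambda>(i, j). e i + d j)"
  unfolding fin_fibres_def
proof
  fix m
  have "{ij \<in> I \<times> J. (case ij of (i, j) \<Rightarrow> e i + d j) = m}
     \<subseteq> (\<Union>k\<in>{0..m}. {i \<in> I. e i = k} \<times> {j \<in> J. d j = m - k})" by auto
  then show "finite {ij \<in> I \<times> J. (case ij of (i, j) \<Rightarrow> e i + d j) = m}"
    by (rule finite_subset) (use assms in \<open>auto simp: fin_fibres_def\<close>)
qed

section \<open>The Jacobi triple product\<close>

text \<open>The Gaussian binomial coefficient by its q-Pascal rule, which makes sense in every
  commutative ring; the usual quotient would need invertible 1 - q^i.\<close>

fun qbinom :: "'a::comm_ring_1 \<Rightarrow> nat \<Rightarrow> nat \<Rightarrow> 'a" where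
  "qbinom q n 0 = 1"
| "qbinom q 0 (Suc k) = 0"
| "qbinom q (Suc n) (Suc k) = qbinom q n k + q ^ Suc k * qbinom q n (Suc k)"

lemma qbinom_eq_0: "n < k \<Longrightarrow> qbinom q n k = 0"
  by (induction q n k rule: qbinom.induct) auto

text \<open>The second q-Pascal rule. The induction for \<open>finite_jacobi_0\<close> needs this
  one, the induction for \<open>finite_jacobi\<close> the defining one.\<close>

lemma qbinom_Suc_Suc':
  "k \<le> n \<Longrightarrow> qbinom q (Suc n) (Suc k) = q ^ (n - k) * qbinom q n k + qbinom q n (Suc k)"
proof (induction n arbitrary: k)
  case (Suc n)
  show ?case
  proof (cases k)
    case 0
    have "qbinom q (Suc (Suc n)) (Suc 0) = 1 + q * qbinom q (Suc n) (Suc 0)"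
      by simp
    also have "\<dots> = 1 + q * (q ^ n + qbinom q n (Suc 0))"
      by (subst Suc.IH) auto
    also have "\<dots> = q ^ Suc n + qbinom q (Suc n) (Suc 0)"
      by (simp add: algebra_simps)
    finally show ?thesis using 0 by simp
  next
    case k: (Suc k')
    show ?thesis
    proof (cases "k' = n")
      case True
      then show ?thesis using k by (simp add: qbinom_eq_0)
    next
      case False
      with Suc.prems k have le: "k' \<le> n" "k \<le> n" by auto
      have "qbinom q (Suc (Suc n)) (Suc k) = qbinom q (Suc n) k + q ^ Suc k * qbinom q (Suc n) (Suc k)"
        by simp
      also have "qbinom q (Suc n) (Suc k) = q ^ (n - k) * qbinom q n k + qbinom q n (Suc k)"
        using Suc.IH le by blast
      also have "qbinom q (Suc n) k = q ^ (n - k') * qbinom q n k' + qbinom q n k"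
        using Suc.IH[OF le(1)] k by simp
      also have "q ^ (n - k') * qbinom q n k' + qbinom q n k +
            q ^ Suc k * (q ^ (n - k) * qbinom q n k + qbinom q n (Suc k))
          = q ^ (n - k') * (qbinom q n k' + q ^ k * qbinom q n k)
            + (qbinom q n k + q ^ Suc k * qbinom q n (Suc k))"
      proof -
        have "q ^ Suc k * q ^ (n - k) = q ^ (n - k') * q ^ k"
          using le k by (simp flip: power_add power_Suc)
        then have "q ^ Suc k * (q ^ (n - k) * qbinom q n k) = q ^ (n - k') * (q ^ k * qbinom q n k)"
          by (metis mult.assoc)
        then show ?thesis by (simp add: algebra_simps)
      qed
      also have "\<dots> = q ^ (Suc n - k) * qbinom q (Suc n) k + qbinom q (Suc n) (Suc k)"
        using k le by simp
      finally show ?thesis .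
    qed
  qed
qed simp

text \<open>The product formula with the denominator multiplied out. For k > n both sides vanish:
  the factor with i = n is 1 - q^0, so truncated subtraction does no harm.\<close>

lemma qbinom_mult_qpoch:
  "qbinom q n k * qpoch q q k = (\<Prod>i<k. 1 - q ^ (n - i))"
proof (induction q n k rule: qbinom.induct)
  case (2 q k)
  have "(\<Prod>i<Suc k. 1 - q ^ (0 - i)) = 0"
    by (intro prod_zero) (auto intro!: bexI[of _ 0])
  then show ?case by simp
next
  case (3 q n k)
  define x P P' where "x = q ^ Suc k" and "P = qpoch q q k" and "P' = qpoch q q (Suc k)"
  have P': "P' = P * (1 - x)"
    by (simp add: P'_def P_def x_def qpoch_def)
  have "qbinom q (Suc n) (Suc k) * P' = (qbinom q n k * P) * (1 - x) + x * (qbinom q n (Suc k) * P')"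
    unfolding qbinom.simps x_def[symmetric] by (simp add: P' algebra_simps)
  also have "\<dots> = (\<Prod>i<k. 1 - q ^ (n - i)) * (1 - q ^ Suc k + q ^ Suc k * (1 - q ^ (n - k)))"
    unfolding 3[folded P_def P'_def] x_def prod.lessThan_Suc by (simp only: algebra_simps)
  also have "\<dots> = (\<Prod>i<k. 1 - q ^ (n - i)) * (1 - q ^ Suc n)"
  proof (cases "k \<le> n")
    case True
    then have "q ^ Suc k * (1 - q ^ (n - k)) = q ^ Suc k - q ^ Suc n"
      by (simp add: right_diff_distrib flip: power_add power_Suc)
    then show ?thesis by simp
  next
    case False
    then have "(\<Prod>i<k. 1 - q ^ (n - i)) = 0"
      by (intro prod_zero) (auto intro!: bexI[of _ n])
    then show ?thesis by simp
  qed
  also have "\<dots> = (\<Prod>i<Suc k. 1 - q ^ (Suc n - i))"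
    by (simp only: prod.lessThan_Suc_shift) (simp add: mult.commute)
  finally show ?case by (simp only: P'_def)
qed (simp add: qpoch_def)

text \<open>Nonnegative on all integers, with \<open>tri (- k)\<close> equal to k(k-1)/2 and
  \<open>tri k - tri (- k)\<close> equal to k. Hence \<open>z ^ tri k * z' ^ tri (- k)\<close> is
  z^k whenever z z' = 1.\<close>

definition tri :: "int \<Rightarrow> nat" where
  "tri k = nat (k * (k + 1) div 2)"

lemma int_tri: "2 * int (tri k) = k * (k + 1)"
proof -
  have "0 \<le> k * (k + 1)"
    by (cases "k \<ge> 0") (auto intro: mult_nonpos_nonpos)
  moreover have "2 dvd k * (k + 1)" by simp
  ultimately show ?thesis
    unfolding tri_def by (simp add: dvd_mult_div_cancel del: dvd_mult_left)
qed

text \<open>Crude, but linear growth suffices for finite fibres and truncations. The loss of 1 is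
  forced by k = -1, where \<open>tri\<close> is 0.\<close>

lemma tri_ge: "nat \<bar>k\<bar> - 1 \<le> tri k"
proof -
  have "2 * (\<bar>k\<bar> - 1) \<le> k * (k + 1)"
  proof (cases "k \<ge> 0")
    case True
    then have "k * 1 \<le> k * k"
      by (cases "k = 0") (auto intro: mult_left_mono)
    with True show ?thesis by (simp add: algebra_simps)
  next
    case False
    then have "0 \<le> (- k - 1) * (- k - 2) \<or> k = - 1"
      by (cases "k = -1") (auto intro: mult_nonneg_nonneg)
    then show ?thesis using False by (auto simp: algebra_simps)
  qed
  then have "2 * (\<bar>k\<bar> - 1) \<le> 2 * int (tri k)"
    by (simp only: int_tri)
  then have "nat \<bar>k\<bar> \<le> tri k + 1"
    by (simp add: nat_le_iff)
  then show ?thesis by simp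
qed

definition alt :: "int \<Rightarrow> 'a::ring_1" where
  "alt k = (if even k then 1 else - 1)"

lemma alt_simps: "alt (k + 1) = - alt k" "alt (k - 1) = - alt k" "alt (- k) = alt k" "alt 0 = 1"
  by (auto simp: alt_def)

context
  fixes u v :: "'a::comm_ring_1"
begin

text \<open>The general term of Ramanujan's theta function f(-u, -v). Two bases with nonnegative
  exponents avoid inverses and let u or v have a constant term.\<close>

definition jterm :: "int \<Rightarrow> 'a" where
  "jterm k = alt k * u ^ tri k * v ^ tri (- k)"

text \<open>The ratio of consecutive terms, - u^(j+1) v^j, multiplied by (u v)^(M-j).
  \<open>jterm_down\<close> does the same at the other end.\<close>

lemma jterm_up: "u * (u * v) ^ M * jterm (int j) = - ((u * v) ^ (M - j) * jterm (int j + 1))"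
  if "j \<le> M"
proof -
  have "Suc M + tri (int j) = M - j + tri (int j + 1)"
       "M + tri (- int j) = M - j + tri (- (int j + 1))"
    using int_tri[of "int j"] int_tri[of "int j + 1"] int_tri[of "- int j"] int_tri[of "- (int j + 1)"] that
    by (simp_all add: algebra_simps)
  then have "u * u ^ M * u ^ tri (int j) = u ^ (M - j) * u ^ tri (int j + 1)"
    "v ^ M * v ^ tri (- int j) = v ^ (M - j) * v ^ tri (- (int j + 1))"
    by (simp_all flip: power_add power_Suc)
  then have "alt (int j) * (u * u ^ M * u ^ tri (int j)) * (v ^ M * v ^ tri (- int j))
    = alt (int j) * (u ^ (M - j) * u ^ tri (int j + 1)) * (v ^ (M - j) * v ^ tri (- (int j + 1)))"
    by simp
  then show ?thesis
    by (simp only: jterm_def alt_simps power_mult_distrib mult_minus_left mult_minus_right minus_minus mult_ac)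
qed

lemma jterm_down: "v * (u * v) ^ N * jterm (int j - int N) = - ((u * v) ^ j * jterm (int j - int N - 1))"
proof -
  define k where "k = int j - int N"
  have "N + tri k = j + tri (k - 1)" "Suc N + tri (- k) = j + tri (- (k - 1))"
    using int_tri[of k] int_tri[of "k - 1"] int_tri[of "- k"] int_tri[of "- (k - 1)"]
    by (simp_all add: algebra_simps k_def)
  then have "u ^ N * u ^ tri k = u ^ j * u ^ tri (k - 1)"
    "v * v ^ N * v ^ tri (- k) = v ^ j * v ^ tri (- (k - 1))"
    by (simp_all flip: power_add power_Suc)
  then have "alt k * (u ^ N * u ^ tri k) * (v * v ^ N * v ^ tri (- k))
    = alt k * (u ^ j * u ^ tri (k - 1)) * (v ^ j * v ^ tri (- (k - 1)))"
    by simp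
  then show ?thesis unfolding k_def[symmetric]
    by (simp only: jterm_def alt_simps power_mult_distrib mult_minus_left mult_minus_right minus_minus mult_ac)
qed

text \<open>Cauchy's q-binomial theorem in the notation of \<open>jterm\<close>: the new factor 1 -
  u (u v)^M moves each term one index up.\<close>

lemma finite_jacobi_0: "qpoch u (u * v) M = (\<Sum>j\<le>M. qbinom (u * v) M j * jterm (int j))"
proof (induction M)
  case 0
  show ?case by (simp add: qpoch_def jterm_def alt_def tri_def)
next
  case (Suc M)
  let ?Q = "u * v"
  have "qpoch u ?Q (Suc M)
      = (\<Sum>j\<le>M. qbinom ?Q M j * jterm (int j)) - (\<Sum>j\<le>M. qbinom ?Q M j * (u * ?Q ^ M * jterm (int j)))"
  proof -
    have "qpoch u ?Q (Suc M) = qpoch u ?Q M - u * ?Q ^ M * qpoch u ?Q M"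
      by (simp add: qpoch_def right_diff_distrib mult.commute[of "prod _ _"] left_diff_distrib)
    then show ?thesis
      by (simp only: Suc.IH sum_distrib_left mult.left_commute)
  qed
  also have "(\<Sum>j\<le>M. qbinom ?Q M j * (u * ?Q ^ M * jterm (int j)))
      = (\<Sum>j\<le>M. - (?Q ^ (M - j) * qbinom ?Q M j * jterm (int (Suc j))))"
  proof (intro sum.cong refl)
    fix j assume "j \<in> {..M}"
    then show "qbinom ?Q M j * (u * ?Q ^ M * jterm (int j)) = - (?Q ^ (M - j) * qbinom ?Q M j * jterm (int (Suc j)))"
      using jterm_up[of j M] by (simp only: atMost_iff of_nat_Suc add.commute[of 1] mult_minus_right mult.left_commute mult.assoc)
  qed
  also have "(\<Sum>j\<le>M. qbinom ?Q M j * jterm (int j)) = (\<Sum>j\<le>Suc M. qbinom ?Q M j * jterm (int j))"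
    by (simp add: qbinom_eq_0)
  also have "\<dots> = jterm 0 + (\<Sum>j\<le>M. qbinom ?Q M (Suc j) * jterm (int (Suc j)))"
    by (simp only: sum.atMost_Suc_shift) simp
  also have "\<dots> - (\<Sum>j\<le>M. - (?Q ^ (M - j) * qbinom ?Q M j * jterm (int (Suc j))))
     = jterm 0 + (\<Sum>j\<le>M. qbinom ?Q (Suc M) (Suc j) * jterm (int (Suc j)))"
  proof -
    have "(\<Sum>j\<le>M. qbinom ?Q (Suc M) (Suc j) * jterm (int (Suc j)))
      = (\<Sum>j\<le>M. qbinom ?Q M (Suc j) * jterm (int (Suc j)) + ?Q ^ (M - j) * qbinom ?Q M j * jterm (int (Suc j)))"
      by (intro sum.cong refl) (simp only: qbinom_Suc_Suc' atMost_iff distrib_right add.commute)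
    then show ?thesis by (simp only: sum.distrib sum_negf diff_minus_eq_add add.assoc)
  qed
  also have "\<dots> = (\<Sum>j\<le>Suc M. qbinom ?Q (Suc M) j * jterm (int j))"
    by (simp only: sum.atMost_Suc_shift) simp
  finally show ?case .
qed

text \<open>The finite form of the triple product. Each new factor of the second product shifts the
  range of the sum down by one, hence the centre \<open>int j - int N\<close>.\<close>

lemma finite_jacobi:
  "qpoch u (u * v) M * qpoch v (u * v) N
     = (\<Sum>j\<le>M + N. qbinom (u * v) (M + N) j * jterm (int j - int N))"
proof (induction N)
  case 0
  then show ?case using finite_jacobi_0 by (simp add: qpoch_def)
next
  case (Suc N)
  let ?Q = "u * v" and ?n = "M + N"
  have "qpoch u ?Q M * qpoch v ?Q (Suc N)
      = (\<Sum>j\<le>?n. qbinom ?Q ?n j * jterm (int j - int N))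
        - v * ?Q ^ N * (\<Sum>j\<le>?n. qbinom ?Q ?n j * jterm (int j - int N))"
  proof -
    have "qpoch v ?Q (Suc N) = qpoch v ?Q N - v * ?Q ^ N * qpoch v ?Q N"
      by (simp add: qpoch_def right_diff_distrib mult.commute[of "prod _ _"] left_diff_distrib)
    then show ?thesis
      by (simp only: Suc.IH right_diff_distrib mult.left_commute[of "qpoch u ?Q M"])
  qed
  also have "v * ?Q ^ N * (\<Sum>j\<le>?n. qbinom ?Q ?n j * jterm (int j - int N))
      = (\<Sum>j\<le>?n. qbinom ?Q ?n j * (v * ?Q ^ N * jterm (int j - int N)))"
    by (simp only: sum_distrib_left mult.left_commute)
  also have "\<dots> = (\<Sum>j\<le>?n. - (?Q ^ j * qbinom ?Q ?n j * jterm (int j - int (Suc N))))"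
  proof (intro sum.cong refl)
    fix j
    have "int j - int N - 1 = int j - int (Suc N)" by simp
    then show "qbinom ?Q ?n j * (v * ?Q ^ N * jterm (int j - int N))
        = - (?Q ^ j * qbinom ?Q ?n j * jterm (int j - int (Suc N)))"
      by (subst jterm_down) (simp only: mult_minus_right mult.left_commute mult.assoc)
  qed
  also have "\<dots> = (\<Sum>j\<le>Suc ?n. - (?Q ^ j * qbinom ?Q ?n j * jterm (int j - int (Suc N))))"
    by (simp add: qbinom_eq_0)
  also have "\<dots> = - jterm (- int (Suc N)) - (\<Sum>j\<le>?n. ?Q ^ Suc j * qbinom ?Q ?n (Suc j) * jterm (int j - int N))"
    by (simp only: sum.atMost_Suc_shift) (simp add: sum_negf del: qbinom.simps(3))
  also have "(\<Sum>j\<le>?n. qbinom ?Q ?n j * jterm (int j - int N)) - \<dots>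
      = jterm (- int (Suc N)) + (\<Sum>j\<le>?n. qbinom ?Q (Suc ?n) (Suc j) * jterm (int j - int N))"
    by (simp add: distrib_right sum.distrib)
  also have "\<dots> = (\<Sum>j\<le>Suc ?n. qbinom ?Q (Suc ?n) j * jterm (int j - int (Suc N)))"
    by (simp only: sum.atMost_Suc_shift) simp
  finally show ?case by simp
qed

end

text \<open>The q-binomial times the infinite product is 1 modulo X^M, with M = min(j, 2N - j) the
  distance of j to the ends, and the term itself is divisible by X^(|j - N| - 1). Since M + |j - N|
  = N, every error has order at least N - 1.\<close>

lemma jacobi_triple_cong:
  fixes u v :: "'a::idom fps"
  assumes Q: "fps_X dvd u * v" and t: "\<And>k. fps_X ^ (nat \<bar>k\<bar> - 1) dvd jterm u v k"
  shows "fps_cong (N - 1) (qpoch_inf (u * v) (u * v) * (qpoch u (u * v) N * qpoch v (u * v) N))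
           (\<Sum>k\<in>{- int N..int N}. jterm u v k)"
proof -
  let ?Q = "u * v"
  have 1: "fps_cong (N - 1) (qpoch_inf ?Q ?Q * (qbinom ?Q (N + N) j * jterm u v (int j - int N)))
      (jterm u v (int j - int N))" if "j \<le> N + N" for j
  proof -
    define M where "M = min j (N + N - j)"
    have "fps_cong M (qpoch_inf ?Q ?Q * qbinom ?Q (N + N) j) (qpoch ?Q ?Q j * qbinom ?Q (N + N) j)"
      by (intro fps_cong_mult qpoch_inf_cong Q fps_cong_refl) (simp add: M_def)
    also have "qpoch ?Q ?Q j * qbinom ?Q (N + N) j = (\<Prod>i<j. 1 - ?Q ^ (N + N - i))"
      by (simp only: qbinom_mult_qpoch mult.commute[of "qpoch ?Q ?Q j"])
    also have "fps_cong M \<dots> (\<Prod>i<j. 1)"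
    proof (intro fps_cong_prod fps_cong_1_minus)
      fix i assume "i \<in> {..<j}"
      then have "M \<le> N + N - i" by (auto simp: M_def)
      then show "fps_X ^ M dvd ?Q ^ (N + N - i)"
        using fps_X_power_dvd_aq[OF Q, of M "N + N - i" 1] by simp
    qed
    finally have "fps_X ^ M dvd qpoch_inf ?Q ?Q * qbinom ?Q (N + N) j - 1"
      by (simp only: fps_cong_def prod.neutral_const)
    then have "fps_X ^ M * fps_X ^ (nat \<bar>int j - int N\<bar> - 1)
       dvd (qpoch_inf ?Q ?Q * qbinom ?Q (N + N) j - 1) * jterm u v (int j - int N)"
      using t by (rule mult_dvd_mono)
    moreover have "N - 1 \<le> M + (nat \<bar>int j - int N\<bar> - 1)"
      using that by (auto simp: M_def)
    then have "(fps_X :: 'a fps) ^ (N - 1) dvd fps_X ^ M * fps_X ^ (nat \<bar>int j - int N\<bar> - 1)"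
      unfolding power_add[symmetric] by (rule le_imp_power_dvd)
    ultimately have "fps_X ^ (N - 1)
       dvd (qpoch_inf ?Q ?Q * qbinom ?Q (N + N) j - 1) * jterm u v (int j - int N)"
      by (rule dvd_trans[rotated])
    then show ?thesis
      by (simp only: fps_cong_def left_diff_distrib mult_1 mult.assoc)
  qed
  have "qpoch_inf ?Q ?Q * (qpoch u ?Q N * qpoch v ?Q N)
      = (\<Sum>j\<le>N + N. qpoch_inf ?Q ?Q * (qbinom ?Q (N + N) j * jterm u v (int j - int N)))"
    by (simp only: finite_jacobi sum_distrib_left)
  also have "fps_cong (N - 1) \<dots> (\<Sum>j\<le>N + N. jterm u v (int j - int N))"
    by (intro fps_cong_sum 1) auto
  also have "(\<Sum>j\<le>N + N. jterm u v (int j - int N)) = (\<Sum>k\<in>{- int N..int N}. jterm u v k)"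
    by (rule sum.reindex_bij_witness[of _ "\<lambda>k. nat (k + int N)" "\<lambda>j. int j - int N"]) auto
  finally show ?thesis .
qed

text \<open>\<open>U\<close> and \<open>V\<close> are described by congruences only, because v may
  have a nonzero constant term: in \<open>theta_product\<close> it is the constant 1/z, where
  \<open>qpoch_inf_cong\<close> does not apply.\<close>

theorem jacobi_triple:
  fixes u v U V :: "'a::idom fps"
  assumes Q: "fps_X dvd u * v"
    and U: "\<And>N. fps_cong N U (qpoch u (u * v) N)" and V: "\<And>N. fps_cong N V (qpoch v (u * v) N)"
    and t: "\<And>k. jterm u v k = fps_const (w k) * fps_X ^ e k" and e: "\<And>k. nat \<bar>k\<bar> - 1 \<le> e k"
  shows "qpoch_inf (u * v) (u * v) * (U * V) = wsum UNIV w e"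
proof (rule fps_eqI_cong)
  fix N
  let ?Q = "u * v"
  have "fps_cong N (qpoch_inf ?Q ?Q * (U * V))
     (qpoch_inf ?Q ?Q * (qpoch u ?Q (Suc N) * qpoch v ?Q (Suc N)))"
    by (intro fps_cong_mult fps_cong_refl fps_cong_mono[OF U] fps_cong_mono[OF V]) auto
  also have "fps_cong N \<dots> (\<Sum>k\<in>{- int (Suc N)..int (Suc N)}. jterm u v k)"
    using jacobi_triple_cong[OF Q, of "Suc N"] e
    by (simp add: t le_imp_power_dvd dvd_mult del: of_nat_Suc)
  also have "\<dots> = wsum {- int (Suc N)..int (Suc N)} w e"
    by (simp add: t wsum_finite)
  also have "fps_cong N \<dots> (wsum UNIV w e)"
  proof (intro fps_cong_sym[OF wsum_trunc])
    fix k assume "k \<notin> {- int (Suc N)..int (Suc N)}"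
    then have "Suc N < nat \<bar>k\<bar>" by auto
    then show "N \<le> e k" using e[of k] by linarith
  qed simp
  finally show "fps_cong N (qpoch_inf ?Q ?Q * (U * V)) (wsum UNIV w e)" .
qed

section \<open>The crank generating function\<close>

text \<open>Integer powers with z' in the role of 1/z. As an argument of its own, the inverse exists
  in any commutative ring, in particular for the power series that replace z in
  \<open>crank_gf'_theta\<close>.\<close>

definition zpow :: "'a::comm_ring_1 \<Rightarrow> 'a \<Rightarrow> int \<Rightarrow> 'a" where
  "zpow z z' k = (if k \<ge> 0 then z ^ nat k else z' ^ nat (- k))"

lemma zpow_diff:
  assumes "z * z' = 1"
  shows "z ^ m * z' ^ n = zpow z z' (int m - int n)"
proof -
  have 1: "z ^ k * z' ^ k = 1" for k
    using assms by (metis power_mult_distrib power_one)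
  show ?thesis
  proof (cases "n \<le> m")
    case True
    then have "z ^ m * z' ^ n = z ^ (m - n) * (z ^ n * z' ^ n)"
      by (simp flip: power_add mult.assoc)
    with True 1 show ?thesis by (simp add: zpow_def nat_diff_distrib')
  next
    case False
    then have "z ^ m * z' ^ n = (z ^ m * z' ^ m) * z' ^ (n - m)"
      by (simp add: mult.assoc flip: power_add)
    with False 1 show ?thesis by (simp add: zpow_def nat_diff_distrib')
  qed
qed

definition theta :: "'a::comm_ring_1 \<Rightarrow> 'a \<Rightarrow> 'a fps" where
  "theta z z' = wsum UNIV (\<lambda>k. alt k * zpow z z' k) tri"

text \<open>The triple product with u = z q and v = 1/z, so that u v = q. The zeroth factor 1 - 1/z
  of the product for v is split off; what remains is the T(z) of the overview.\<close>

lemma theta_product: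
  fixes z z' :: "'a::idom"
  assumes z: "z * z' = 1"
  shows "theta z z' = fps_const (1 - z') * (qpoch_inf fps_X fps_X
           * (qpoch_inf (fps_const z * fps_X) fps_X * qpoch_inf (fps_const z' * fps_X) fps_X))"
proof -
  define u v :: "'a fps" where "u = fps_const z * fps_X" and "v = fps_const z'"
  have uv: "u * v = fps_X"
    using z by (simp add: u_def v_def mult_ac)
  have "qpoch_inf (u * v) (u * v) * (qpoch_inf u (u * v) * ((1 - v) * qpoch_inf (v * (u * v)) (u * v)))
      = wsum UNIV (\<lambda>k. alt k * zpow z z' k) tri"
  proof (rule jacobi_triple)
    show "fps_X dvd u * v" by (simp add: uv)
    show "fps_cong N (qpoch_inf u (u * v)) (qpoch u (u * v) N)" for N
      by (intro qpoch_inf_cong) (simp_all add: uv, simp add: u_def)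
    show "fps_cong N ((1 - v) * qpoch_inf (v * (u * v)) (u * v)) (qpoch v (u * v) N)" for N
    proof -
      have "fps_cong N ((1 - v) * qpoch_inf (v * (u * v)) (u * v)) ((1 - v) * qpoch (v * (u * v)) (u * v) N)"
        by (intro fps_cong_mult fps_cong_refl qpoch_inf_cong) (simp_all add: uv)
      also have "(1 - v) * qpoch (v * (u * v)) (u * v) N = qpoch v (u * v) (Suc N)"
        by (simp only: qpoch_def prod.lessThan_Suc_shift) (simp add: mult.assoc)
      also have "fps_cong N \<dots> (qpoch v (u * v) N)"
        by (rule qpoch_cong_Suc) (simp_all add: uv)
      finally show ?thesis .
    qed
    show "jterm u v k = fps_const (alt k * zpow z z' k) * fps_X ^ tri k" for k
    proof -
      have "2 * (int (tri k) - int (tri (- k))) = 2 * k"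
        using int_tri[of k] int_tri[of "- k"] by (simp add: algebra_simps)
      then have "int (tri k) - int (tri (- k)) = k"
        by simp
      then have "z ^ tri k * z' ^ tri (- k) = zpow z z' k"
        using zpow_diff[OF z, of "tri k" "tri (- k)"] by simp
      then have "fps_const (alt k * zpow z z' k) = fps_const (alt k) * (fps_const z ^ tri k * fps_const z' ^ tri (- k))"
        by (simp add: fps_const_power)
      moreover have "fps_const (alt k) = (alt k :: 'a fps)"
        by (simp add: alt_def flip: fps_const_neg)
      ultimately show ?thesis
        by (simp only: jterm_def u_def v_def power_mult_distrib mult_ac)
    qed
    show "nat \<bar>k\<bar> - 1 \<le> tri k" for k by (rule tri_ge)
  qed
  then show ?thesis
    by (simp only: uv theta_def) (simp add: u_def v_def mult_ac flip: fps_const_sub)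
qed

lemma qpoch_inf_nth_0:
  fixes a :: "'a::idom fps"
  assumes "fps_X dvd q" "fps_X dvd a"
  shows "fps_nth (qpoch_inf a q) 0 = 1"
proof -
  have "fps_nth a 0 = 0"
    using assms(2) by (metis fps_X_power_dvd_iff power_one_right less_one)
  then show ?thesis
    using qpoch_inf_cong[OF assms, of 1 1] by (simp add: fps_cong_iff qpoch_def)
qed

section \<open>Generating functions of partitions by number of parts and by crank\<close>

lemma finite_partitions: "finite {p. is_partition p \<and> \<Sum>\<^sub># p = n}"
proof (rule finite_subset)
  show "{p. is_partition p \<and> \<Sum>\<^sub># p = n} \<subseteq> hd ` colored_partitions 1 n"
    by (force simp: colored_partitions_def image_iff intro: exI[of _ "[_]"])
  show "finite (hd ` colored_partitions 1 n)"
    by (intro finite_imageI finite_colored_partitions)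
qed

lemma fin_fibres_partitions: "P \<subseteq> Collect is_partition \<Longrightarrow> fin_fibres P sum_mset"
  unfolding fin_fibres_def by (intro allI finite_subset[OF _ finite_partitions]) auto

definition partition_gf :: "'a::comm_ring_1 \<Rightarrow> 'a fps" where
  "partition_gf z = wsum (Collect is_partition) (\<lambda>p. z ^ size p) sum_mset"

text \<open>Part sizes are removed from below: with G m the series of partitions into parts greater
  than m, either m + 1 is not a part or one copy of it can be taken away, so (1 - z q^(m+1)) G m = G
  (m+1), and G m tends to 1.\<close>

lemma partition_gf_qpoch_inf:
  fixes z :: "'a::idom"
  shows "partition_gf z * qpoch_inf (fps_const z * fps_X) fps_X = 1"
proof -
  define P where "P m = {p :: nat multiset. \<forall>x\<in>#p. m < x}" for m
  define G where "G m = wsum (P m) (\<lambda>p. z ^ size p) sum_mset" for m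
  have P_sub: "P m \<subseteq> Collect is_partition" for m
    by (auto simp: P_def is_partition_def)
  have step: "G m = G (Suc m) + fps_const z * fps_X ^ Suc m * G m" for m
  proof -
    have P_Un: "P m = P (Suc m) \<union> add_mset (Suc m) ` P m"
    proof (intro equalityI subsetI)
      fix p assume p: "p \<in> P m"
      show "p \<in> P (Suc m) \<union> add_mset (Suc m) ` P m"
      proof (cases "Suc m \<in># p")
        case True
        then obtain p' where "p = add_mset (Suc m) p'" by (meson multi_member_split)
        with p show ?thesis by (auto simp: P_def)
      next
        case False
        with p show ?thesis by (auto simp: P_def intro: Suc_lessI)
      qed
    qed (auto simp: P_def)
    have "G m = wsum (P (Suc m) \<union> add_mset (Suc m) ` P m) (\<lambda>p. z ^ size p) sum_mset"
      using P_Un by (simp add: G_def)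
    also have "\<dots> = G (Suc m) + wsum (add_mset (Suc m) ` P m) (\<lambda>p. z ^ size p) sum_mset"
      unfolding G_def
    proof (rule wsum_Un)
      show "fin_fibres (P (Suc m) \<union> add_mset (Suc m) ` P m) sum_mset"
        using P_Un fin_fibres_partitions[OF P_sub] by metis
    qed (auto simp: P_def)
    also have "wsum (add_mset (Suc m) ` P m) (\<lambda>p. z ^ size p) sum_mset
       = wsum (P m) ((\<lambda>p. z ^ size p) \<circ> add_mset (Suc m)) (sum_mset \<circ> add_mset (Suc m))"
      by (rule wsum_reindex) (auto simp: bij_betw_def inj_on_def)
    also have "\<dots> = wsum (P m) (\<lambda>p. z * z ^ size p) (\<lambda>p. Suc m + \<Sum>\<^sub># p)"
      by (rule wsum_cong) auto
    also have "\<dots> = fps_const z * fps_X ^ Suc m * G m"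
      by (simp only: wsum_cmult wsum_shift G_def mult.assoc)
    finally show ?thesis .
  qed
  have G: "qpoch (fps_const z * fps_X) fps_X m * G 0 = G m" for m
  proof (induction m)
    case (Suc m)
    have "qpoch (fps_const z * fps_X) fps_X (Suc m) * G 0
       = (1 - fps_const z * fps_X ^ Suc m) * (qpoch (fps_const z * fps_X) fps_X m * G 0)"
      by (simp add: qpoch_def mult_ac)
    also have "\<dots> = (1 - fps_const z * fps_X ^ Suc m) * G m"
      by (simp only: Suc.IH)
    also have "\<dots> = G (Suc m)"
      using step[of m] by (simp add: algebra_simps)
    finally show ?case .
  qed (simp add: qpoch_def)
  have G_1: "fps_cong m (G m) 1" for m
  proof -
    have "fps_cong m (G m) (wsum {{#}} (\<lambda>p. z ^ size p) sum_mset)"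
      unfolding G_def
    proof (rule wsum_trunc)
      fix p assume "p \<in> P m" "p \<notin> {{#}}"
      then obtain x p' where "p = add_mset x p'" "m < x"
        by (cases p) (auto simp: P_def)
      then show "m \<le> \<Sum>\<^sub># p" by simp
    qed (auto simp: P_def)
    then show ?thesis by (simp add: wsum_finite)
  qed
  have "fps_cong m (G 0 * qpoch_inf (fps_const z * fps_X) fps_X) 1" for m
  proof -
    have "fps_cong m (G 0 * qpoch_inf (fps_const z * fps_X) fps_X) (G 0 * qpoch (fps_const z * fps_X) fps_X m)"
      by (intro fps_cong_mult fps_cong_refl qpoch_inf_cong) auto
    also have "G 0 * qpoch (fps_const z * fps_X) fps_X m = G m"
      using G by (simp only: mult.commute)
    also have "fps_cong m \<dots> 1"
      by (rule G_1)
    finally show ?thesis .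
  qed
  then have "G 0 * qpoch_inf (fps_const z * fps_X) fps_X = 1"
    by (rule fps_eqI_cong)
  moreover have "P 0 = Collect is_partition"
    by (auto simp: P_def is_partition_def intro: gr0I)
  ultimately show ?thesis
    by (simp add: G_def partition_gf_def)
qed

definition crank_gf :: "'a::comm_ring_1 \<Rightarrow> 'a \<Rightarrow> 'a fps" where
  "crank_gf z z' = Abs_fps (\<lambda>n. \<Sum>ps\<in>colored_partitions 3 n. zpow z z' (crank ps))"

lemma crank_gf_eq:
  assumes z: "z * z' = 1"
  shows "crank_gf z z' = partition_gf z * (partition_gf z' * partition_gf 1)"
proof -
  let ?P = "Collect is_partition"
  define T where "T = {ps. length ps = 3 \<and> (\<forall>p\<in>set ps. is_partition p)}"
  have fin: "fin_fibres ?P sum_mset"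
    by (rule fin_fibres_partitions) simp
  have "partition_gf z * (partition_gf z' * partition_gf 1)
     = wsum (?P \<times> ?P \<times> ?P) (\<lambda>(p, p'). z ^ size p * (case p' of (p2, p3) \<Rightarrow> z' ^ size p2 * 1 ^ size p3))
        (\<lambda>(p, p'). \<Sum>\<^sub># p + (case p' of (p2, p3) \<Rightarrow> \<Sum>\<^sub># p2 + \<Sum>\<^sub># p3))"
    unfolding partition_gf_def wsum_mult[OF fin fin]
    by (rule wsum_mult[OF fin fin_fibres_Times[OF fin fin]])
  also have "\<dots> = wsum (?P \<times> ?P \<times> ?P) ((\<lambda>ps. zpow z z' (crank ps)) \<circ> (\<lambda>(p1, p2, p3). [p1, p2, p3]))
      ((\<lambda>ps. \<Sum>p\<leftarrow>ps. \<Sum>\<^sub># p) \<circ> (\<lambda>(p1, p2, p3). [p1, p2, p3]))"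
    by (rule wsum_cong) (auto simp: crank_def zpow_diff[OF z])
  also have "\<dots> = wsum T (\<lambda>ps. zpow z z' (crank ps)) (\<lambda>ps. \<Sum>p\<leftarrow>ps. \<Sum>\<^sub># p)"
  proof (rule wsum_reindex[symmetric])
    have "T \<subseteq> (\<lambda>(p1, p2, p3). [p1, p2, p3]) ` (?P \<times> ?P \<times> ?P)"
      by (auto simp: T_def length_Suc_conv numeral_3_eq_3 image_iff)
    then show "bij_betw (\<lambda>(p1, p2, p3). [p1, p2, p3]) (?P \<times> ?P \<times> ?P) T"
      by (intro bij_betwI') (auto simp: T_def image_iff)
  qed
  also have "\<dots> = crank_gf z z'"
    by (auto simp: fps_eq_iff wsum_nth crank_gf_def T_def colored_partitions_def intro!: sum.cong)
  finally show ?thesis ..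
qed

lemma crank_gf_qpoch_inf:
  fixes z z' :: "'a::idom"
  assumes "z * z' = 1"
  shows "crank_gf z z' * (qpoch_inf fps_X fps_X
           * (qpoch_inf (fps_const z * fps_X) fps_X * qpoch_inf (fps_const z' * fps_X) fps_X)) = 1"
proof -
  have "crank_gf z z' * (qpoch_inf fps_X fps_X
           * (qpoch_inf (fps_const z * fps_X) fps_X * qpoch_inf (fps_const z' * fps_X) fps_X))
     = (partition_gf z * qpoch_inf (fps_const z * fps_X) fps_X)
       * ((partition_gf z' * qpoch_inf (fps_const z' * fps_X) fps_X)
       * (partition_gf 1 * qpoch_inf fps_X fps_X))"
    by (simp only: crank_gf_eq[OF assms] mult_ac)
  moreover have "partition_gf 1 * qpoch_inf fps_X fps_X = (1 :: 'a fps)"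
    using partition_gf_qpoch_inf[of "1::'a"] by simp
  ultimately show ?thesis
    by (simp only: partition_gf_qpoch_inf mult_1)
qed

text \<open>Unlike in F(z) T(z) = 1, both series on the left are explicit sums of powers of z, so
  that this form can be differentiated term by term.\<close>

lemma crank_gf_theta:
  fixes z z' :: "'a::idom"
  assumes "z * z' = 1"
  shows "crank_gf z z' * theta z z' = fps_const (1 - z')"
  using crank_gf_qpoch_inf[OF assms] by (simp add: theta_product[OF assms] mult.left_commute)

section \<open>The derivative with respect to z\<close>

text \<open>Meant for series in q whose coefficients are series in a second variable t: it extracts
  the coefficient of t^j throughout.\<close>

definition coeff_fps :: "nat \<Rightarrow> 'a::comm_ring_1 fps fps \<Rightarrow> 'a fps" where
  "coeff_fps j f = Abs_fps (\<lambda>n. fps_nth (fps_nth f n) j)"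

lemma coeff_fps_mult_1:
  "coeff_fps 1 (f * g) = coeff_fps 1 f * coeff_fps 0 g + coeff_fps 0 f * coeff_fps 1 g"
  by (simp add: fps_eq_iff coeff_fps_def fps_mult_nth fps_sum_nth sum.distrib add.commute)

text \<open>The prime denotes z d/dz and not d/dz, here and in \<open>crank_gf'\<close>.\<close>

definition theta' :: "'a::comm_ring_1 \<Rightarrow> 'a \<Rightarrow> 'a fps" where
  "theta' z z' = wsum UNIV (\<lambda>k. alt k * of_int k * zpow z z' k) tri"

definition crank_gf' :: "'a::comm_ring_1 \<Rightarrow> 'a \<Rightarrow> 'a fps" where
  "crank_gf' z z' = Abs_fps (\<lambda>n. \<Sum>ps\<in>colored_partitions 3 n. of_int (crank ps) * zpow z z' (crank ps))"

lemma crank_gf'_theta: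
  fixes z z' :: complex
  assumes "z * z' = 1"
  shows "crank_gf' z z' * theta z z' + crank_gf z z' * theta' z z' = fps_const z'"
proof -
  \<comment> \<open>The derivative in z is the t-linear coefficient at z e^t, where e^t is itself a power series.\<close>
  define y y' where "y = fps_const z * fps_exp 1" and "y' = fps_const z' * fps_exp (- 1)"
  have yy': "y * y' = 1"
  proof -
    have "y * y' = fps_const (z * z') * (fps_exp 1 * fps_exp (- 1))"
      by (simp add: y_def y'_def mult_ac flip: fps_const_mult)
    then show ?thesis by (simp add: assms flip: fps_exp_add_mult)
  qed
  have zpow: "zpow y y' k = fps_const (zpow z z' k) * fps_exp (of_int k)" for k
    by (auto simp: zpow_def y_def y'_def power_mult_distrib fps_const_power fps_exp_power_mult)
  have zpow_nth: "fps_nth (zpow y y' k) 0 = zpow z z' k" "fps_nth (zpow y y' k) 1 = of_int k * zpow z z' k" for k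
    by (simp_all add: zpow)
  have alt: "(alt k :: complex fps) = fps_const (alt k)" for k
    by (simp add: alt_def flip: fps_const_neg)
  have "coeff_fps 0 (crank_gf y y') = crank_gf z z'" "coeff_fps 1 (crank_gf y y') = crank_gf' z z'"
    by (simp_all add: fps_eq_iff coeff_fps_def crank_gf_def crank_gf'_def fps_sum_nth zpow_nth del: One_nat_def)
  moreover have "coeff_fps 0 (theta y y') = theta z z'" "coeff_fps 1 (theta y y') = theta' z z'"
    by (simp_all add: fps_eq_iff coeff_fps_def theta_def theta'_def wsum_nth fps_sum_nth alt zpow_nth mult.assoc
          del: One_nat_def)
  moreover have "coeff_fps 1 (crank_gf y y' * theta y y') = fps_const z'"
    unfolding crank_gf_theta[OF yy'] by (simp add: fps_eq_iff coeff_fps_def y'_def)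
  ultimately show ?thesis
    by (simp only: coeff_fps_mult_1)
qed

section \<open>Theta series modulo 5\<close>

definition dilate5 :: "'a::comm_ring_1 fps \<Rightarrow> 'a fps" where
  "dilate5 f = fps_compose f (fps_X ^ 5)"

lemma dilate5_hom:
  fixes f g :: "'a::idom fps"
  shows "dilate5 (f + g) = dilate5 f + dilate5 g" "dilate5 (f - g) = dilate5 f - dilate5 g" "dilate5 (- f) = - dilate5 f" "dilate5 (f * g) = dilate5 f * dilate5 g"
    "dilate5 (f ^ n) = dilate5 f ^ n" "dilate5 (fps_const c) = fps_const c" "dilate5 0 = 0" "dilate5 1 = 1" "dilate5 fps_X = fps_X ^ 5"
    "dilate5 (numeral k) = numeral k"
  by (simp_all add: dilate5_def fps_compose_add_distrib fps_compose_sub_distrib fps_compose_uminus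
        fps_compose_mult_distrib fps_compose_power)

lemma dilate5_prod: "dilate5 (prod (f :: _ \<Rightarrow> 'a::idom fps) A) = prod (\<lambda>i. dilate5 (f i)) A"
  by (simp add: dilate5_def fps_compose_prod_distrib)

lemma dilate5_nth: "fps_nth (dilate5 f) n = (if 5 dvd n then fps_nth f (n div 5) else 0)"
proof -
  have "fps_nth (dilate5 f) n = (\<Sum>i=0..n. if 5 * i = n then fps_nth f i else 0)"
    by (auto simp: dilate5_def fps_compose_nth fps_X_power_nth simp flip: power_mult intro!: sum.cong)
  also have "\<dots> = (\<Sum>i\<in>{i\<in>{0..n}. 5 * i = n}. fps_nth f i)"
    by (simp only: sum.inter_filter finite_atLeastAtMost)
  also have "{i\<in>{0..n}. 5 * i = n} = (if 5 dvd n then {n div 5} else {})"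
    by auto
  finally show ?thesis by simp
qed

lemma dilate5_wsum: "dilate5 (wsum I w e) = wsum I w (\<lambda>i. 5 * e i)"
proof -
  have "(if 5 dvd n then \<Sum>i | i \<in> I \<and> e i = n div 5. w i else 0) = (\<Sum>i | i \<in> I \<and> 5 * e i = n. w i)" for n
    by (cases "5 dvd n") (auto intro!: sum.cong sum.neutral)
  then show ?thesis
    by (simp only: fps_eq_iff dilate5_nth wsum_nth) simp
qed

lemma dilate5_cong: "fps_cong N f g \<Longrightarrow> fps_cong N (dilate5 f) (dilate5 g)"
  using le_trans[OF div_le_dividend] by (force simp: fps_cong_iff dilate5_nth)

lemma dilate5_qpoch_inf:
  fixes a q :: "'a::idom fps"
  assumes "fps_X dvd a" "fps_X dvd q"
  shows "dilate5 (qpoch_inf a q) = qpoch_inf (dilate5 a) (dilate5 q)"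
proof (rule fps_eqI_cong)
  fix N
  have dvd: "fps_X dvd dilate5 f" if "fps_X dvd f" for f :: "'a fps"
    using that by (auto simp: dilate5_hom dvd_def numeral_eq_Suc)
  have "fps_cong N (dilate5 (qpoch_inf a q)) (dilate5 (qpoch a q N))"
    by (intro dilate5_cong qpoch_inf_cong assms) simp
  also have "dilate5 (qpoch a q N) = qpoch (dilate5 a) (dilate5 q) N"
    by (simp add: qpoch_def dilate5_prod dilate5_hom)
  also have "fps_cong N \<dots> (qpoch_inf (dilate5 a) (dilate5 q))"
    by (intro fps_cong_sym[OF qpoch_inf_cong] dvd assms) simp
  finally show "fps_cong N (dilate5 (qpoch_inf a q)) (qpoch_inf (dilate5 a) (dilate5 q))" .
qed

definition section5 :: "nat \<Rightarrow> 'a::comm_ring_1 fps \<Rightarrow> 'a fps" where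
  "section5 r f = Abs_fps (\<lambda>n. fps_nth f (5 * n + r))"

lemma section5_add: "section5 r (f + g) = section5 r f + section5 r g"
  and section5_diff: "section5 r (f - g) = section5 r f - section5 r g"
  by (simp_all add: section5_def fps_eq_iff)

lemma section5_dilate5:
  assumes "r < 5" "s < 5"
  shows "section5 r (fps_X ^ s * dilate5 f) = (if r = s then f else 0)"
proof -
  have "5 * n + r < s \<longleftrightarrow> n = 0 \<and> r < s" for n
    using assms by auto
  moreover have "5 dvd 5 * n + r - s \<longleftrightarrow> r = s" if "\<not> 5 * n + r < s" for n
    using that assms by presburger
  ultimately show ?thesis
    using assms by (auto simp: section5_def fps_eq_iff fps_X_power_mult_nth dilate5_nth)
qed

lemma section5_dilate5_0: "r < 5 \<Longrightarrow> section5 r (dilate5 f) = (if r = 0 then f else 0)"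
  using section5_dilate5[of r 0 f] by simp

lemma section5_dilate5_1: "r < 5 \<Longrightarrow> section5 r (fps_X * dilate5 f) = (if r = 1 then f else 0)"
  using section5_dilate5[of r 1 f] by simp

lemma dilate5_inj: "dilate5 f = dilate5 g \<Longrightarrow> f = g"
  by (metis section5_dilate5_0 zero_less_numeral)

text \<open>In Jacobi's form, \<open>exp_b\<close> belongs to (u, v) = (q^3, q^2) and
  \<open>exp_a\<close> to (q^4, q), whence the products B E5 and A E5.\<close>

definition exp_b :: "int \<Rightarrow> nat" where "exp_b k = nat (k * (5 * k + 1) div 2)"
definition exp_a :: "int \<Rightarrow> nat" where "exp_a k = nat (k * (5 * k + 3) div 2)"

lemma exp_b_eq: "exp_b k = 3 * tri k + 2 * tri (- k)"
proof -
  have "2 * int (3 * tri k + 2 * tri (- k)) = k * (5 * k + 1)"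
    using int_tri[of k] int_tri[of "- k"] by (simp add: algebra_simps)
  then show ?thesis unfolding exp_b_def by (metis nat_int nonzero_mult_div_cancel_left zero_neq_numeral)
qed

lemma exp_a_eq: "exp_a k = 4 * tri k + tri (- k)"
proof -
  have "2 * int (4 * tri k + tri (- k)) = k * (5 * k + 3)"
    using int_tri[of k] int_tri[of "- k"] by (simp add: algebra_simps)
  then show ?thesis unfolding exp_a_def by (metis nat_int nonzero_mult_div_cancel_left zero_neq_numeral)
qed

text \<open>\<open>tri\<close> is invariant under k -> -1 - k. This pairs the residue classes 0 with
  4 and 1 with 3 modulo 5, while class 2 is mapped to itself and reproduces \<open>tri\<close> at
  scale 25.\<close>

lemma tri_mod5:
  "tri (5 * k) = 5 * exp_b k" "tri (- 1 - 5 * k) = 5 * exp_b k"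
  "tri (5 * k + 1) = 1 + 5 * exp_a k" "tri (- 2 - 5 * k) = 1 + 5 * exp_a k"
  "tri (5 * k + 2) = 3 + 5 * (5 * tri k)"
  unfolding exp_b_eq exp_a_eq
  using int_tri[of k] int_tri[of "- k"] int_tri[of "5 * k"] int_tri[of "- 1 - 5 * k"]
    int_tri[of "5 * k + 1"] int_tri[of "- 2 - 5 * k"] int_tri[of "5 * k + 2"]
  by (simp_all add: algebra_simps)

lemma fin_fibresI_abs:
  assumes "\<And>k :: int. nat \<bar>k\<bar> - 1 \<le> e k"
  shows "fin_fibres K e"
  unfolding fin_fibres_def
proof
  fix m
  have "{k \<in> K. e k = m} \<subseteq> {- int (m + 1)..int (m + 1)}"
  proof
    fix k assume "k \<in> {k \<in> K. e k = m}"
    then show "k \<in> {- int (m + 1)..int (m + 1)}"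
      using assms[of k] by auto
  qed
  then show "finite {k \<in> K. e k = m}"
    by (rule finite_subset) simp
qed

lemma wsum_tri_mod5:
  fixes w :: "int \<Rightarrow> 'a::idom"
  shows "wsum UNIV w tri =
      dilate5 (wsum UNIV (\<lambda>k. w (5 * k)) exp_b) + dilate5 (wsum UNIV (\<lambda>k. w (- 1 - 5 * k)) exp_b)
      + fps_X * dilate5 (wsum UNIV (\<lambda>k. w (5 * k + 1)) exp_a) + fps_X * dilate5 (wsum UNIV (\<lambda>k. w (- 2 - 5 * k)) exp_a)
      + fps_X ^ 3 * dilate5 (dilate5 (wsum UNIV (\<lambda>k. w (5 * k + 2)) tri))"
proof -
  have "UNIV = range (\<lambda>k. 5 * k) \<union> (range (\<lambda>k. - 1 - 5 * k) \<union> (range (\<lambda>k. 5 * k + 1)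
      \<union> (range (\<lambda>k. - 2 - 5 * k) \<union> range (\<lambda>k :: int. 5 * k + 2))))" (is "_ = ?U")
  proof (intro equalityI subsetI)
    fix n :: int
    have "(\<exists>k. n = 5 * k) \<or> (\<exists>k. n = - 1 - 5 * k) \<or> (\<exists>k. n = 5 * k + 1) \<or> (\<exists>k. n = - 2 - 5 * k)
      \<or> (\<exists>k. n = 5 * k + 2)"
      by presburger
    then show "n \<in> ?U" by blast
  qed simp
  then have "wsum UNIV w tri = wsum ?U w tri"
    by simp
  also have "\<dots> = wsum (range (\<lambda>k. 5 * k)) w tri + (wsum (range (\<lambda>k. - 1 - 5 * k)) w tri
     + (wsum (range (\<lambda>k. 5 * k + 1)) w tri
     + (wsum (range (\<lambda>k. - 2 - 5 * k)) w tri + wsum (range (\<lambda>k. 5 * k + 2)) w tri)))"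
  proof -
    have fin: "fin_fibres K tri" for K
      using tri_ge by (rule fin_fibresI_abs)
    show ?thesis
      by (subst wsum_Un[OF fin], (auto; presburger)[1])+ simp
  qed
  also have "wsum (range (\<lambda>k. 5 * k)) w tri = wsum UNIV (w \<circ> (\<lambda>k. 5 * k)) (tri \<circ> (\<lambda>k. 5 * k))"
    by (rule wsum_reindex) (auto simp: bij_betw_def inj_on_def)
  also have "wsum (range (\<lambda>k. - 1 - 5 * k)) w tri = wsum UNIV (w \<circ> (\<lambda>k. - 1 - 5 * k)) (tri \<circ> (\<lambda>k. - 1 - 5 * k))"
    by (rule wsum_reindex) (auto simp: bij_betw_def inj_on_def)
  also have "wsum (range (\<lambda>k. 5 * k + 1)) w tri = wsum UNIV (w \<circ> (\<lambda>k. 5 * k + 1)) (tri \<circ> (\<lambda>k. 5 * k + 1))"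
    by (rule wsum_reindex) (auto simp: bij_betw_def inj_on_def)
  also have "wsum (range (\<lambda>k. - 2 - 5 * k)) w tri = wsum UNIV (w \<circ> (\<lambda>k. - 2 - 5 * k)) (tri \<circ> (\<lambda>k. - 2 - 5 * k))"
    by (rule wsum_reindex) (auto simp: bij_betw_def inj_on_def)
  also have "wsum (range (\<lambda>k. 5 * k + 2)) w tri = wsum UNIV (w \<circ> (\<lambda>k. 5 * k + 2)) (tri \<circ> (\<lambda>k. 5 * k + 2))"
    by (rule wsum_reindex) (auto simp: bij_betw_def inj_on_def)
  finally show ?thesis
    by (simp only: comp_def tri_mod5 dilate5_wsum wsum_shift power_one_right add.assoc)
qed

abbreviation theta_b :: "complex fps" where "theta_b \<equiv> wsum UNIV alt exp_b"
abbreviation theta_a :: "complex fps" where "theta_a \<equiv> wsum UNIV alt exp_a"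
abbreviation theta_b' :: "complex fps" where "theta_b' \<equiv> wsum UNIV (\<lambda>k. alt k * of_int k) exp_b"
abbreviation theta_a' :: "complex fps" where "theta_a' \<equiv> wsum UNIV (\<lambda>k. alt k * of_int k) exp_a"

lemma jacobi_triple_X:
  assumes "r > 0" "s > 0"
  shows "qpoch_inf (fps_X ^ (r + s)) (fps_X ^ (r + s))
       * (qpoch_inf (fps_X ^ r) (fps_X ^ (r + s)) * qpoch_inf (fps_X ^ s) (fps_X ^ (r + s)))
     = (wsum UNIV alt (\<lambda>k. r * tri k + s * tri (- k)) :: complex fps)"
  unfolding power_add
proof (rule jacobi_triple)
  have dvd: "fps_X dvd (fps_X :: complex fps) ^ n" if "n > 0" for n
    using that by (simp add: dvd_power)
  show Q: "fps_X dvd (fps_X :: complex fps) ^ r * fps_X ^ s"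
    using assms dvd by (intro dvd_mult2) auto
  show "fps_cong N (qpoch_inf (fps_X ^ r) (fps_X ^ r * fps_X ^ s))
      (qpoch (fps_X ^ r) (fps_X ^ r * fps_X ^ s) N :: complex fps)"
    "fps_cong N (qpoch_inf (fps_X ^ s) (fps_X ^ r * fps_X ^ s))
      (qpoch (fps_X ^ s) (fps_X ^ r * fps_X ^ s) N :: complex fps)" for N
    using assms by (intro qpoch_inf_cong Q dvd order_refl; simp)+
  show "jterm (fps_X ^ r) (fps_X ^ s) k
     = fps_const (alt k) * (fps_X :: complex fps) ^ (r * tri k + s * tri (- k))" for k
  proof -
    have "(alt k :: complex fps) = fps_const (alt k)"
      by (simp add: alt_def flip: fps_const_neg)
    then show ?thesis
      by (simp add: jterm_def power_add power_mult mult.assoc)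
  qed
  show "nat \<bar>k\<bar> - 1 \<le> r * tri k + s * tri (- k)" for k
  proof -
    have "nat \<bar>k\<bar> - 1 \<le> 1 * tri k"
      using tri_ge by simp
    also have "\<dots> \<le> r * tri k"
      using assms by (intro mult_right_mono) auto
    finally show ?thesis by simp
  qed
qed

lemma theta_b_eq: "theta_b = qpoch_inf (fps_X ^ 5) (fps_X ^ 5) * qpoch_infs [fps_X ^ 2, fps_X ^ 3] (fps_X ^ 5)"
  using jacobi_triple_X[of 3 2] by (simp add: qpoch_infs_def exp_b_eq[abs_def] mult_ac)

lemma theta_a_eq: "theta_a = qpoch_inf (fps_X ^ 5) (fps_X ^ 5) * qpoch_infs [fps_X, fps_X ^ 4] (fps_X ^ 5)"
  using jacobi_triple_X[of 4 1] by (simp add: qpoch_infs_def exp_a_eq[abs_def] mult_ac)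

abbreviation euler_fps :: "complex fps" where "euler_fps \<equiv> qpoch_inf fps_X fps_X"

definition theta_prod :: "complex \<Rightarrow> complex \<Rightarrow> complex fps" where
  "theta_prod z z' = euler_fps * (qpoch_inf (fps_const z * fps_X) fps_X * qpoch_inf (fps_const z' * fps_X) fps_X)"

text \<open>At z = 1 the factor 1 - 1/z kills the theta series. This removes class 2 from
  \<open>theta_mod5\<close> and its unweighted share from \<open>theta'_mod5\<close>.\<close>

lemma wsum_alt_tri: "wsum UNIV alt tri = (0 :: complex fps)"
proof -
  have "zpow 1 1 = (\<lambda>_. 1 :: complex)"
    by (simp add: zpow_def fun_eq_iff)
  then show ?thesis
    using theta_product[of 1 "1 :: complex"] by (simp add: theta_def)
qed

text \<open>Jacobi's series for the cube of the Euler product, as a corollary of the crank: at z = 1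
  \<open>theta\<close> vanishes, so \<open>crank_gf'_theta\<close> leaves F(1) theta'(1) = 1, while
  F(1) E1^3 = 1.\<close>

lemma wsum_alt_tri': "wsum UNIV (\<lambda>k. alt k * of_int k) tri = euler_fps ^ 3"
proof -
  have "crank_gf 1 1 * euler_fps ^ 3 = 1"
    using crank_gf_qpoch_inf[of 1 "1 :: complex"] by (simp add: power3_eq_cube mult.assoc)
  moreover have "crank_gf 1 1 * theta' 1 1 = (1 :: complex fps)"
    using crank_gf'_theta[of 1 1] theta_product[of 1 "1 :: complex"] by simp
  ultimately have "theta' 1 1 = euler_fps ^ 3"
    by (metis mult.left_commute mult.right_neutral)
  moreover have "zpow 1 1 = (\<lambda>_. 1 :: complex)"
    by (simp add: zpow_def fun_eq_iff)
  ultimately show ?thesis by (simp add: theta'_def)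
qed

lemma wsum_alt_linear:
  "wsum UNIV (\<lambda>k. c * alt k + d * (alt k * of_int k)) e
     = fps_const c * wsum UNIV alt e + fps_const d * wsum UNIV (\<lambda>k. alt k * of_int k) e"
  by (simp only: wsum_add wsum_cmult)

lemma alt_mod5:
  "alt (5 * k) = (alt k :: 'a::ring_1)" "alt (- 1 - 5 * k) = (- alt k :: 'a)" "alt (5 * k + 1) = (- alt k :: 'a)"
  "alt (- 2 - 5 * k) = (alt k :: 'a)" "alt (5 * k + 2) = (alt k :: 'a)"
  by (auto simp: alt_def)

lemma zpow_mod5:
  fixes z :: complex
  assumes "z ^ 5 = 1"
  shows "zpow z (z ^ 4) (5 * k) = 1" "zpow z (z ^ 4) (- 1 - 5 * k) = z ^ 4" "zpow z (z ^ 4) (5 * k + 1) = z"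
    "zpow z (z ^ 4) (- 2 - 5 * k) = z ^ 3" "zpow z (z ^ 4) (5 * k + 2) = z ^ 2"
proof -
  have "z \<noteq> 0" using assms by auto
  have z4: "z ^ 4 = inverse z"
    using assms by (intro inverse_unique[symmetric]) (simp flip: power_Suc)
  have zpow: "zpow z (z ^ 4) k = z powi k" for k
    by (simp add: z4 zpow_def power_int_def)
  have 5: "z powi (5 * k) = 1" for k
    using assms by (simp add: power_int_mult)
  have 1: "z powi (5 * k + l) = z powi l" for l k
    using 5 \<open>z \<noteq> 0\<close> by (simp add: power_int_add)
  have "- 1 - 5 * k = 5 * (- 1 - k) + 4" "- 2 - 5 * k = 5 * (- 1 - k) + 3"
    by simp_all
  then show "zpow z (z ^ 4) (- 1 - 5 * k) = z ^ 4" "zpow z (z ^ 4) (- 2 - 5 * k) = z ^ 3"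
    by (simp_all only: zpow 1 power_int_numeral)
  show "zpow z (z ^ 4) (5 * k) = 1" "zpow z (z ^ 4) (5 * k + 1) = z" "zpow z (z ^ 4) (5 * k + 2) = z ^ 2"
    by (simp_all only: zpow 1 5 power_int_numeral power_int_1_right)
qed

lemma theta_mod5:
  fixes z :: complex
  assumes z: "z ^ 5 = 1"
  shows "theta z (z ^ 4) = fps_const (1 - z ^ 4) * dilate5 theta_b + fps_const (z ^ 3 - z) * fps_X * dilate5 theta_a"
proof -
  define w where "w = (\<lambda>k. alt k * zpow z (z ^ 4) k)"
  have w: "w (5 * k) = 1 * alt k" "w (- 1 - 5 * k) = - (z ^ 4) * alt k" "w (5 * k + 1) = (- z) * alt k"
     "w (- 2 - 5 * k) = z ^ 3 * alt k" "w (5 * k + 2) = z ^ 2 * alt k" for k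
    by (simp_all add: w_def alt_mod5 zpow_mod5[OF z])
  have "theta z (z ^ 4) = wsum UNIV w tri"
    by (simp add: theta_def w_def)
  also have "\<dots> = dilate5 (fps_const 1 * theta_b) + dilate5 (fps_const (- (z ^ 4)) * theta_b)
     + fps_X * dilate5 (fps_const (- z) * theta_a) + fps_X * dilate5 (fps_const (z ^ 3) * theta_a)
     + fps_X ^ 3 * dilate5 (dilate5 (fps_const (z ^ 2) * 0))"
    \<comment> \<open>Read from right to left: the literal 0 stands for the vanishing series of
      class 2.\<close>
    unfolding wsum_tri_mod5[of w] wsum_alt_tri[symmetric] wsum_cmult[symmetric] w ..
  also have "\<dots> = fps_const (1 - z ^ 4) * dilate5 theta_b + fps_const (z ^ 3 - z) * fps_X * dilate5 theta_a"
    by (simp add: dilate5_hom algebra_simps flip: fps_const_sub fps_const_neg)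
  finally show ?thesis .
qed

text \<open>In each class the weight n is linear in k and splits into a plain and a weighted series;
  in class 2 only the weighted one survives, E1^3 at q^25. The hypothesis admits z = 1, which yields
  the dissection of E1^3 itself.\<close>

lemma theta'_mod5:
  fixes z :: complex
  assumes z: "z ^ 5 = 1"
  shows "theta' z (z ^ 4) = fps_const (5 * (1 + z ^ 4)) * dilate5 theta_b' + fps_const (z ^ 4) * dilate5 theta_b
     - fps_const (z + 2 * z ^ 3) * fps_X * dilate5 theta_a - fps_const (5 * (z + z ^ 3)) * fps_X * dilate5 theta_a'
     + fps_const (5 * z ^ 2) * fps_X ^ 3 * dilate5 (dilate5 euler_fps) ^ 3"
proof -
  define w where "w = (\<lambda>k. alt k * of_int k * zpow z (z ^ 4) k)"
  have w: "w (5 * k) = 0 * alt k + 5 * (alt k * of_int k)"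
     "w (- 1 - 5 * k) = z ^ 4 * alt k + (5 * z ^ 4) * (alt k * of_int k)"
     "w (5 * k + 1) = (- z) * alt k + (- 5 * z) * (alt k * of_int k)"
     "w (- 2 - 5 * k) = (- 2 * z ^ 3) * alt k + (- 5 * z ^ 3) * (alt k * of_int k)"
     "w (5 * k + 2) = (2 * z ^ 2) * alt k + (5 * z ^ 2) * (alt k * of_int k)" for k
    unfolding w_def alt_mod5 zpow_mod5[OF z] by (simp_all add: algebra_simps)
  have "theta' z (z ^ 4) = wsum UNIV w tri"
    by (simp add: theta'_def w_def)
  also have "\<dots> = dilate5 (fps_const 0 * theta_b + fps_const 5 * theta_b') + dilate5 (fps_const (z ^ 4) * theta_b + fps_const (5 * z ^ 4) * theta_b')
     + fps_X * dilate5 (fps_const (- z) * theta_a + fps_const (- 5 * z) * theta_a')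
     + fps_X * dilate5 (fps_const (- 2 * z ^ 3) * theta_a + fps_const (- 5 * z ^ 3) * theta_a')
     + fps_X ^ 3 * dilate5 (dilate5 (fps_const (2 * z ^ 2) * 0 + fps_const (5 * z ^ 2) * euler_fps ^ 3))"
    unfolding wsum_tri_mod5[of w] wsum_alt_tri[symmetric] wsum_alt_tri'[symmetric] wsum_alt_linear[symmetric] w ..
  also have "\<dots> = fps_const (5 * (1 + z ^ 4)) * dilate5 theta_b' + fps_const (z ^ 4) * dilate5 theta_b
     - fps_const (z + 2 * z ^ 3) * fps_X * dilate5 theta_a - fps_const (5 * (z + z ^ 3)) * fps_X * dilate5 theta_a'
     + fps_const (5 * z ^ 2) * fps_X ^ 3 * dilate5 (dilate5 euler_fps) ^ 3"
    by (simp add: dilate5_hom algebra_simps flip: fps_const_add fps_const_mult fps_const_neg)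
  finally show ?thesis .
qed

section \<open>Relations between the theta series and the Euler product\<close>

lemma cyclotomic5_power:
  fixes c :: "'a::comm_ring_1"
  assumes "c ^ 4 + c ^ 3 + c ^ 2 + c + 1 = 0"
  shows "c ^ 5 = 1"
proof -
  have "c ^ 5 - 1 = (c - 1) * (c ^ 4 + c ^ 3 + c ^ 2 + c + 1)"
    by (simp add: algebra_simps eval_nat_numeral)
  then show ?thesis by (simp add: assms)
qed

text \<open>Stated over a commutative ring because c will be a constant power series. Conjugate
  factors are paired; the two quadratics involve only the Gaussian periods s and t, with s + t = s t
  = -1.\<close>

lemma prod_cyclotomic5:
  fixes c x y :: "'a::comm_ring_1"
  assumes c: "c ^ 4 + c ^ 3 + c ^ 2 + c + 1 = 0"
  shows "(x - y) * (x - c * y) * (x - c ^ 2 * y) * (x - c ^ 3 * y) * (x - c ^ 4 * y) = x ^ 5 - y ^ 5"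
proof -
  define s t where "s = c + c ^ 4" and "t = c ^ 2 + c ^ 3"
  have c5: "c ^ 5 = 1" by (rule cyclotomic5_power[OF c])
  have st: "s + t = - 1"
    using c by (simp add: s_def t_def algebra_simps eq_neg_iff_add_eq_0)
  have "s * t = c ^ 3 + c ^ 4 + c ^ 5 * (c + c ^ 2)"
    by (simp add: s_def t_def algebra_simps flip: power_add power_Suc)
  then have "s * t = s + t"
    using c5 by (simp add: s_def t_def algebra_simps)
  with st have st': "s * t = - 1" by simp
  have "(x - c * y) * (x - c ^ 4 * y) = x ^ 2 - s * x * y + c ^ 5 * y ^ 2"
    by (simp add: s_def algebra_simps power2_eq_square eval_nat_numeral)
  moreover have "(x - c ^ 2 * y) * (x - c ^ 3 * y) = x ^ 2 - t * x * y + c ^ 5 * y ^ 2"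
    by (simp add: t_def algebra_simps power2_eq_square eval_nat_numeral)
  moreover have "(x - c * y) * (x - c ^ 2 * y) * (x - c ^ 3 * y) * (x - c ^ 4 * y)
      = ((x - c * y) * (x - c ^ 4 * y)) * ((x - c ^ 2 * y) * (x - c ^ 3 * y))"
    by (simp only: mult_ac)
  ultimately have "(x - c * y) * (x - c ^ 2 * y) * (x - c ^ 3 * y) * (x - c ^ 4 * y)
      = (x ^ 2 - s * x * y + y ^ 2) * (x ^ 2 - t * x * y + y ^ 2)"
    by (simp only: c5 mult_1)
  also have "\<dots> = x ^ 4 + y ^ 4 + 2 * x ^ 2 * y ^ 2 - (s + t) * (x ^ 3 * y + x * y ^ 3) + (s * t) * x ^ 2 * y ^ 2"
    by (simp add: algebra_simps eval_nat_numeral)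
  also have "\<dots> = x ^ 4 + x ^ 3 * y + x ^ 2 * y ^ 2 + x * y ^ 3 + y ^ 4"
    unfolding st st' by (simp add: algebra_simps)
  finally have "(x - y) * ((x - c * y) * (x - c ^ 2 * y) * (x - c ^ 3 * y) * (x - c ^ 4 * y))
     = (x - y) * (x ^ 4 + x ^ 3 * y + x ^ 2 * y ^ 2 + x * y ^ 3 + y ^ 4)"
    by simp
  also have "\<dots> = x ^ 5 - y ^ 5"
    by (simp add: algebra_simps eval_nat_numeral)
  finally show ?thesis by (simp add: mult.assoc)
qed

lemma dilate5_euler_fps: "dilate5 euler_fps = qpoch_inf (fps_X ^ 5) (fps_X ^ 5)"
  by (simp add: dilate5_qpoch_inf dilate5_hom)

context
  fixes z :: complex
  assumes z: "z ^ 4 + z ^ 3 + z ^ 2 + z + 1 = 0"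
begin

lemma z5: "z ^ 5 = 1"
  by (rule cyclotomic5_power[OF z])

lemma z_power_ge5: "z ^ (5 + n) = z ^ n"
  by (simp add: power_add z5)

lemma z_reduce: "z ^ 5 = 1" "z ^ 6 = z" "z ^ 7 = z ^ 2" "z ^ 8 = z ^ 3" "z ^ 9 = z ^ 4"
  "z ^ 10 = 1" "z ^ 11 = z" "z ^ 12 = z ^ 2"
  using z_power_ge5[of 0] z_power_ge5[of 1] z_power_ge5[of 2] z_power_ge5[of 3] z_power_ge5[of 4]
    z_power_ge5[of 5] z_power_ge5[of 6] z_power_ge5[of 7] by simp_all

lemma z_neq_1: "z \<noteq> 1"
  using z by auto

lemma cyclotomic5_conj:
  "(z ^ 2) ^ 4 + (z ^ 2) ^ 3 + (z ^ 2) ^ 2 + z ^ 2 + 1 = 0"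
  "(z ^ 3) ^ 4 + (z ^ 3) ^ 3 + (z ^ 3) ^ 2 + z ^ 3 + 1 = 0"
  "(z ^ 4) ^ 4 + (z ^ 4) ^ 3 + (z ^ 4) ^ 2 + z ^ 4 + 1 = 0"
proof -
  have "z ^ 16 = z" using z_power_ge5[of 11] by (simp add: z_reduce)
  then show "(z ^ 2) ^ 4 + (z ^ 2) ^ 3 + (z ^ 2) ^ 2 + z ^ 2 + 1 = 0"
    "(z ^ 3) ^ 4 + (z ^ 3) ^ 3 + (z ^ 3) ^ 2 + z ^ 3 + 1 = 0"
    "(z ^ 4) ^ 4 + (z ^ 4) ^ 3 + (z ^ 4) ^ 2 + z ^ 4 + 1 = 0"
    using z by (simp_all add: z_reduce algebra_simps flip: power_mult)
qed

lemma one_minus_z4_neq_0: "1 - z ^ 4 \<noteq> 0"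
proof
  assume "1 - z ^ 4 = 0"
  then have "z ^ 4 * z = z" by simp
  then have "z ^ 5 = z" by (simp flip: power_Suc2)
  then show False using z5 z_neq_1 by simp
qed

lemma theta_eq_theta_prod: "theta z (z ^ 4) = fps_const (1 - z ^ 4) * theta_prod z (z ^ 4)"
  unfolding theta_prod_def by (rule theta_product) (use z5 in \<open>simp flip: power_Suc\<close>)

text \<open>Origin of kappa: cancelling 1 - z^4 in \<open>theta_mod5\<close> gives (z^3 - z) / (1 -
  z^4) = z^2 + z^3.\<close>

lemma theta_prod_mod5: "theta_prod z (z ^ 4) = dilate5 theta_b + fps_const (z ^ 2 + z ^ 3) * fps_X * dilate5 theta_a"
proof -
  have "(1 - z ^ 4) * (z ^ 2 + z ^ 3) = z ^ 3 - z"
    by (simp add: algebra_simps z_reduce flip: power_add)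
  then have "fps_const (1 - z ^ 4) * theta_prod z (z ^ 4)
     = fps_const (1 - z ^ 4) * (dilate5 theta_b + fps_const (z ^ 2 + z ^ 3) * fps_X * dilate5 theta_a)"
    unfolding theta_eq_theta_prod[symmetric] theta_mod5[OF z5]
    by (simp only: distrib_left fps_const_mult flip: mult.assoc)
  then show ?thesis
    using one_minus_z4_neq_0 by (simp del: fps_const_sub add: fps_const_sub[symmetric])
qed

text \<open>As z^3 is the inverse of z^2, the two factors together run over all nontrivial fifth
  roots of unity. One Euler product supplies the root 1 and completes the Euler product at q^5; the
  other remains.\<close>

lemma theta_prod_mult: "theta_prod z (z ^ 4) * theta_prod (z ^ 2) (z ^ 3) = euler_fps * dilate5 euler_fps"
proof -
  define Q where "Q c = qpoch_inf (fps_const c * fps_X) (fps_X :: complex fps)" for c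
  have "euler_fps * Q z * Q (z ^ 2) * Q (z ^ 3) * Q (z ^ 4) = dilate5 euler_fps"
  proof (rule fps_eqI_cong)
    fix N
    define R where "R c = qpoch (fps_const c * fps_X) (fps_X :: complex fps) N" for c
    have Q: "fps_cong N (Q c) (R c)" for c
      unfolding Q_def R_def by (rule qpoch_inf_cong) auto
    have euler_fps: "fps_cong N euler_fps (R 1)"
      unfolding R_def by (simp, rule qpoch_inf_cong) auto
    have "fps_cong N (euler_fps * Q z * Q (z ^ 2) * Q (z ^ 3) * Q (z ^ 4)) (R 1 * R z * R (z ^ 2) * R (z ^ 3) * R (z ^ 4))"
      by (intro fps_cong_mult Q euler_fps)
    also have "R 1 * R z * R (z ^ 2) * R (z ^ 3) * R (z ^ 4) = qpoch (fps_X ^ 5) (fps_X ^ 5) N"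
      unfolding R_def qpoch_def prod.distrib[symmetric]
    proof (rule prod.cong[OF refl])
      fix i
      define c :: "complex fps" where "c = fps_const z"
      have "c ^ 4 + c ^ 3 + c ^ 2 + c + 1 = fps_const (z ^ 4 + z ^ 3 + z ^ 2 + z + 1)"
        by (simp add: c_def fps_const_power flip: fps_const_add)
      then have "c ^ 4 + c ^ 3 + c ^ 2 + c + 1 = 0"
        using z by simp
      from prod_cyclotomic5[OF this, of 1 "fps_X ^ Suc i"]
      show "(1 - fps_const 1 * fps_X * fps_X ^ i) * (1 - fps_const z * fps_X * fps_X ^ i) * (1 - fps_const (z ^ 2) * fps_X * fps_X ^ i)
        * (1 - fps_const (z ^ 3) * fps_X * fps_X ^ i) * (1 - fps_const (z ^ 4) * fps_X * fps_X ^ i)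
        = 1 - fps_X ^ 5 * (fps_X ^ 5) ^ i"
        unfolding c_def by (simp add: fps_const_power mult.assoc power_mult_distrib mult.commute[of _ 5] flip: power_mult)
    qed
    also have "fps_cong N \<dots> (dilate5 euler_fps)"
      unfolding dilate5_euler_fps by (intro fps_cong_sym[OF qpoch_inf_cong]) (auto simp: dvd_power)
    finally show "fps_cong N (euler_fps * Q z * Q (z ^ 2) * Q (z ^ 3) * Q (z ^ 4)) (dilate5 euler_fps)" .
  qed
  then show ?thesis
    unfolding theta_prod_def Q_def by (simp add: mult_ac)
qed

end

lemma ex_cyclotomic5: "\<exists>z :: complex. z ^ 4 + z ^ 3 + z ^ 2 + z + 1 = 0"
proof -
  have "\<not> constant (poly [:1, 1, 1, 1, 1 :: complex:])"
    by (simp add: constant_degree)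
  then obtain z :: complex where "poly [:1, 1, 1, 1, 1:] z = 0"
    using fundamental_theorem_of_algebra by blast
  then have "z ^ 4 + z ^ 3 + z ^ 2 + z + 1 = 0"
    by (simp add: algebra_simps eval_nat_numeral)
  then show ?thesis ..
qed

lemma theta_prod_mod5':
  assumes z: "z ^ 4 + z ^ 3 + z ^ 2 + z + 1 = (0 :: complex)"
  shows "theta_prod (z ^ 2) (z ^ 3) = dilate5 theta_b + fps_const (z + z ^ 4) * fps_X * dilate5 theta_a"
  using theta_prod_mod5[OF cyclotomic5_conj(1)[OF z]]
  by (simp add: z_reduce[OF z] add.commute flip: power_mult)

text \<open>The constants kappa and kappa' of T(z) and T(z^2) have sum and product -1, so the roots
  of unity disappear.\<close>

lemma euler_fps_mod5: "euler_fps * dilate5 euler_fps = dilate5 theta_b ^ 2 - fps_X * dilate5 theta_a * dilate5 theta_b - fps_X ^ 2 * dilate5 theta_a ^ 2"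
proof -
  obtain z :: complex where z: "z ^ 4 + z ^ 3 + z ^ 2 + z + 1 = 0"
    using ex_cyclotomic5 by blast
  define k k' where "k = fps_const (z ^ 2 + z ^ 3)" and "k' = fps_const (z + z ^ 4)"
  have "k + k' = - 1"
  proof -
    have "k + k' = fps_const (z ^ 4 + z ^ 3 + z ^ 2 + z + 1) - 1"
      by (simp add: k_def k'_def flip: fps_const_add)
    then show ?thesis by (simp add: z)
  qed
  moreover have "k * k' = k + k'"
  proof -
    have "(z ^ 2 + z ^ 3) * (z + z ^ 4) = (z ^ 2 + z ^ 3) + (z + z ^ 4)"
      by (simp add: algebra_simps z_reduce[OF z] flip: power_add power_Suc power_Suc2)
    then show ?thesis
      unfolding k_def k'_def by (simp only: fps_const_mult fps_const_add)
  qed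
  moreover have "euler_fps * dilate5 euler_fps = (dilate5 theta_b + k * fps_X * dilate5 theta_a) * (dilate5 theta_b + k' * fps_X * dilate5 theta_a)"
    unfolding theta_prod_mult[OF z, symmetric] theta_prod_mod5[OF z] theta_prod_mod5'[OF z] k_def k'_def ..
  then have "euler_fps * dilate5 euler_fps = dilate5 theta_b ^ 2 + (k + k') * (fps_X * dilate5 theta_a * dilate5 theta_b)
      + (k * k') * (fps_X ^ 2 * dilate5 theta_a ^ 2)"
    by (simp add: algebra_simps power2_eq_square)
  ultimately show ?thesis by simp
qed

lemma euler_fps_cubed_mod5:
  "euler_fps ^ 3 = dilate5 (theta_b + 10 * theta_b') - fps_X * dilate5 (3 * theta_a + 10 * theta_a') + 5 * fps_X ^ 3 * dilate5 (dilate5 euler_fps ^ 3)"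
proof -
  \<comment> \<open>The trivial root z = 1, with its inverse in the shape that
    \<open>theta'_mod5\<close> expects.\<close>
  have "euler_fps ^ 3 = theta' 1 (1 ^ 4)"
    unfolding wsum_alt_tri'[symmetric] theta'_def by (intro wsum_cong) (auto simp: zpow_def)
  also have "\<dots> = 10 * dilate5 theta_b' + dilate5 theta_b - 3 * fps_X * dilate5 theta_a - 10 * fps_X * dilate5 theta_a'
     + 5 * fps_X ^ 3 * dilate5 (dilate5 euler_fps) ^ 3"
    by (subst theta'_mod5) (simp_all add: numeral_fps_const)
  also have "\<dots> = dilate5 (theta_b + 10 * theta_b') - fps_X * dilate5 (3 * theta_a + 10 * theta_a') + 5 * fps_X ^ 3 * dilate5 (dilate5 euler_fps ^ 3)"
    by (simp add: dilate5_hom algebra_simps)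
  finally show ?thesis .
qed

text \<open>E1^3 E5^3 expanded twice. The cube of y^2 - x y - x^2 has no terms x^2 y^4 and x^4 y^2,
  and x is q times a series in q^5, so both expansions live in the classes 0, 1 and 3 modulo
  5.\<close>

lemma euler_fps_sixth_mod5:
  "dilate5 ((theta_b + 10 * theta_b') * euler_fps ^ 3) - fps_X * dilate5 ((3 * theta_a + 10 * theta_a') * euler_fps ^ 3)
      + fps_X ^ 3 * dilate5 (5 * euler_fps ^ 3 * dilate5 euler_fps ^ 3)
   = dilate5 (theta_b ^ 6 - 3 * fps_X * theta_a ^ 5 * theta_b) - fps_X * dilate5 (3 * theta_a * theta_b ^ 5 + fps_X * theta_a ^ 6)
      + fps_X ^ 3 * dilate5 (5 * theta_a ^ 3 * theta_b ^ 3)"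
proof -
  define x y where "x = fps_X * dilate5 theta_a" and "y = dilate5 theta_b"
  have "dilate5 ((theta_b + 10 * theta_b') * euler_fps ^ 3) - fps_X * dilate5 ((3 * theta_a + 10 * theta_a') * euler_fps ^ 3)
      + fps_X ^ 3 * dilate5 (5 * euler_fps ^ 3 * dilate5 euler_fps ^ 3) = euler_fps ^ 3 * dilate5 euler_fps ^ 3"
  proof -
    have "euler_fps ^ 3 * dilate5 euler_fps ^ 3 = (dilate5 (theta_b + 10 * theta_b') - fps_X * dilate5 (3 * theta_a + 10 * theta_a')
        + 5 * fps_X ^ 3 * dilate5 (dilate5 euler_fps ^ 3)) * dilate5 euler_fps ^ 3"
      by (simp only: euler_fps_cubed_mod5[symmetric])
    also have "\<dots> = dilate5 ((theta_b + 10 * theta_b') * euler_fps ^ 3) - fps_X * dilate5 ((3 * theta_a + 10 * theta_a') * euler_fps ^ 3)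
      + fps_X ^ 3 * dilate5 (5 * euler_fps ^ 3 * dilate5 euler_fps ^ 3)"
      by (simp add: dilate5_hom algebra_simps)
    finally show ?thesis ..
  qed
  also have "\<dots> = (y ^ 2 - x * y - x ^ 2) ^ 3"
    using euler_fps_mod5 by (simp add: x_def y_def power_mult_distrib flip: power_mult_distrib[of euler_fps])
  also have "\<dots> = y ^ 6 - 3 * x * y ^ 5 + 5 * x ^ 3 * y ^ 3 - 3 * x ^ 5 * y - x ^ 6"
    by (simp add: algebra_simps eval_nat_numeral)
  also have "\<dots> = dilate5 (theta_b ^ 6 - 3 * fps_X * theta_a ^ 5 * theta_b) - fps_X * dilate5 (3 * theta_a * theta_b ^ 5 + fps_X * theta_a ^ 6)
      + fps_X ^ 3 * dilate5 (5 * theta_a ^ 3 * theta_b ^ 3)"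
    by (simp add: x_def y_def dilate5_hom algebra_simps power_mult_distrib flip: power_add power_Suc)
  finally show ?thesis .
qed

lemma dilate5_mod5_eqD:
  assumes "dilate5 f - fps_X * dilate5 g + fps_X ^ 3 * dilate5 h = dilate5 f' - fps_X * dilate5 g' + fps_X ^ 3 * dilate5 h'"
  shows "f = f'" "g = g'" "h = h'"
  using arg_cong[OF assms, of "section5 0"] arg_cong[OF assms, of "section5 1"] arg_cong[OF assms, of "section5 3"]
  by (simp_all add: section5_add section5_diff section5_dilate5 section5_dilate5_0 section5_dilate5_1)

text \<open>Classes 0 and 1 eliminate b' and a'; class 3 becomes
  \<open>theta_a_theta_b\<close>.\<close>

lemmas theta_b'_eq = dilate5_mod5_eqD(1)[OF euler_fps_sixth_mod5]
lemmas theta_a'_eq = dilate5_mod5_eqD(2)[OF euler_fps_sixth_mod5]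

lemma theta_nth_0: "fps_nth theta_a 0 = 1" "fps_nth theta_b 0 = 1" "fps_nth euler_fps 0 = 1" "fps_nth (dilate5 euler_fps) 0 = 1"
proof -
  have dvd: "fps_X dvd (fps_X :: complex fps) ^ n" if "n > 0" for n
    using that by (simp add: dvd_power)
  show "fps_nth theta_a 0 = 1" "fps_nth theta_b 0 = 1"
    unfolding theta_a_eq theta_b_eq by (simp_all add: qpoch_infs_def qpoch_inf_nth_0 dvd)
  show euler_fps: "fps_nth euler_fps 0 = 1"
    by (simp add: qpoch_inf_nth_0)
  show "fps_nth (dilate5 euler_fps) 0 = 1"
    by (simp add: dilate5_nth euler_fps)
qed

text \<open>Class 3 gives equality of the cubes, and the cube root is unique because the cofactor
  x^2 + x y + y^2 has constant term 3.\<close>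

lemma theta_a_theta_b: "theta_a * theta_b = euler_fps * dilate5 euler_fps"
proof -
  define x y where "x = euler_fps * dilate5 euler_fps" and "y = theta_a * theta_b"
  have "5 * x ^ 3 = 5 * y ^ 3"
    using dilate5_mod5_eqD(3)[OF euler_fps_sixth_mod5] by (simp add: x_def y_def power_mult_distrib mult.assoc)
  then have "(x - y) * (x ^ 2 + x * y + y ^ 2) = 0"
    by (simp add: algebra_simps eval_nat_numeral)
  moreover have "fps_nth (x ^ 2 + x * y + y ^ 2) 0 = 3"
    by (simp add: x_def y_def theta_nth_0 power2_eq_square)
  then have "x ^ 2 + x * y + y ^ 2 \<noteq> 0"
    by (metis fps_zero_nth zero_neq_numeral)
  ultimately show ?thesis by (simp add: x_def y_def)
qed

section \<open>The norm from series in q to series in q^5\<close>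

definition rescale :: "complex \<Rightarrow> complex fps \<Rightarrow> complex fps" where
  "rescale c f = fps_compose f (fps_const c * fps_X)"

lemma rescale_hom:
  "rescale c (f + g) = rescale c f + rescale c g" "rescale c (f - g) = rescale c f - rescale c g"
  "rescale c (f * g) = rescale c f * rescale c g" "rescale c (f ^ n) = rescale c f ^ n"
  "rescale c fps_X = fps_const c * fps_X" "rescale c 1 = 1"
  by (simp_all add: rescale_def fps_compose_add_distrib fps_compose_sub_distrib
        fps_compose_mult_distrib fps_compose_power)

lemma rescale_dilate5: "c ^ 5 = 1 \<Longrightarrow> rescale c (dilate5 f) = dilate5 f"
  by (auto simp: rescale_def fps_eq_iff dilate5_nth power_mult elim!: dvdE)

lemma rescale_cong: "fps_cong N f g \<Longrightarrow> fps_cong N (rescale c f) (rescale c g)"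
  by (simp add: fps_cong_iff rescale_def)

context
  fixes z :: complex
  assumes z: "z ^ 4 + z ^ 3 + z ^ 2 + z + 1 = 0"
begin

definition norm5 :: "complex fps \<Rightarrow> complex fps" where
  "norm5 f = f * rescale z f * rescale (z ^ 2) f * rescale (z ^ 3) f * rescale (z ^ 4) f"

lemma norm5_mult: "norm5 (f * g) = norm5 f * norm5 g"
  by (simp add: norm5_def rescale_hom mult_ac)

lemma norm5_1: "norm5 1 = 1"
  by (simp add: norm5_def rescale_hom)

lemma norm5_prod: "norm5 (prod f A) = prod (\<lambda>i. norm5 (f i)) A"
  by (induction A rule: infinite_finite_induct) (simp_all add: norm5_mult norm5_1)

lemma norm5_dilate5: "norm5 (dilate5 f) = dilate5 f ^ 5"
proof -
  have "(z ^ i) ^ 5 = 1" for i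
    by (metis power_mult mult.commute power_one z5[OF z])
  then have r: "rescale (z ^ i) (dilate5 f) = dilate5 f" for i
    by (rule rescale_dilate5)
  then show ?thesis
    using r[of 1] by (simp add: norm5_def) (simp add: eval_nat_numeral mult.assoc)
qed

lemma norm5_cong: "fps_cong N f g \<Longrightarrow> fps_cong N (norm5 f) (norm5 g)"
  unfolding norm5_def by (intro fps_cong_mult rescale_cong)

lemma norm5_one_minus_X_power:
  assumes "\<not> 5 dvd m"
  shows "norm5 (1 - fps_X ^ m) = 1 - fps_X ^ (5 * m)"
proof -
  define c :: "complex fps" where "c = fps_const (z ^ m)"
  have "z ^ m = z ^ (m mod 5 + 5 * (m div 5))"
    by simp
  also have "\<dots> = z ^ (m mod 5)"
    unfolding power_add power_mult z5[OF z] by simp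
  finally have "z ^ m = z ^ (m mod 5)" .
  moreover have "m mod 5 \<in> {1, 2, 3, 4}"
  proof -
    have "m mod 5 \<noteq> 0" "m mod 5 < 5" using assms by presburger+
    then show ?thesis by auto
  qed
  ultimately have "(z ^ m) ^ 4 + (z ^ m) ^ 3 + (z ^ m) ^ 2 + z ^ m + 1 = 0"
    using z cyclotomic5_conj[OF z] by auto
  then have c: "c ^ 4 + c ^ 3 + c ^ 2 + c + 1 = 0"
    unfolding c_def by (metis fps_const_0_eq_0 fps_const_1_eq_1 fps_const_add fps_const_power)
  have "rescale (z ^ j) (1 - fps_X ^ m) = 1 - c ^ j * fps_X ^ m" for j
    by (simp add: rescale_hom c_def power_mult_distrib fps_const_power mult.commute flip: power_mult)
  from this[of 1] this[of 2] this[of 3] this[of 4] show ?thesis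
    using prod_cyclotomic5[OF c, of 1 "fps_X ^ m"]
    by (simp add: norm5_def power_mult mult.commute[of 5])
qed

text \<open>Factors with index m prime to 5 have norm 1 - q^(5m), the others are raised to the fifth
  power. The former multiply to the Euler product at q^5 over that at q^25, the latter to the fifth
  power of the one at q^5.\<close>

lemma norm5_euler_fps: "norm5 euler_fps * dilate5 (dilate5 euler_fps) = dilate5 euler_fps ^ 6"
proof (rule fps_eqI_cong)
  fix N
  define p :: "nat \<Rightarrow> complex fps" where "p n = 1 - fps_X ^ n" for n
  have norm: "norm5 (p m) = (if 5 dvd m then p m ^ 5 else p (5 * m))" for m
  proof (cases "5 dvd m")
    case True
    then obtain k where "m = 5 * k" by blast
    then have "p m = dilate5 (1 - fps_X ^ k)"
      by (simp add: p_def dilate5_hom power_mult)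
    with True show ?thesis by (simp add: norm5_dilate5)
  next
    case False
    then show ?thesis by (simp add: p_def norm5_one_minus_X_power)
  qed
  have euler_fps: "fps_cong N euler_fps (\<Prod>i<M. p (Suc i))" if "N \<le> M" for M
    using qpoch_inf_cong[of fps_X fps_X N M] that by (simp add: qpoch_def p_def)
  \<comment> \<open>The lengths 5N and N match: exactly N of the indices up to 5N are multiples of
    5, so the truncated identity is exact and follows by induction, five factors at a time.\<close>
  have "fps_cong N (norm5 euler_fps * dilate5 (dilate5 euler_fps)) (norm5 (\<Prod>i<5 * N. p (Suc i)) * dilate5 (dilate5 (\<Prod>i<N. p (Suc i))))"
    by (intro fps_cong_mult norm5_cong dilate5_cong euler_fps) auto
  also have "norm5 (\<Prod>i<5 * N. p (Suc i)) * dilate5 (dilate5 (\<Prod>i<N. p (Suc i)))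
     = (\<Prod>i<5 * N. norm5 (p (Suc i))) * (\<Prod>i<N. p (25 * Suc i))"
    by (simp add: norm5_prod dilate5_prod p_def dilate5_hom power_add flip: power_mult)
  also have "\<dots> = (\<Prod>i<5 * N. p (5 * Suc i)) * (\<Prod>i<N. p (5 * Suc i)) ^ 5"
  proof (induction N)
    case (Suc N)
    have unroll: "(\<Prod>i<5 * Suc N. f i)
      = (\<Prod>i<5 * N. f i) * (f (5 * N) * f (5 * N + 1) * f (5 * N + 2) * f (5 * N + 3) * f (5 * N + 4))"
      for f :: "nat \<Rightarrow> complex fps"
      by (simp add: eval_nat_numeral mult.assoc)
    define P Q R S where "P = (\<Prod>i<5 * N. norm5 (p (Suc i)))" and "Q = (\<Prod>i<N. p (25 * Suc i))"
      and "R = (\<Prod>i<5 * N. p (5 * Suc i))" and "S = (\<Prod>i<N. p (5 * Suc i))"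
    define n where "n i = p (5 * Suc (5 * N + i))" for i
    have IH: "P * Q = R * S ^ 5"
      using Suc.IH by (simp only: P_def Q_def R_def S_def)
    have "\<not> 5 dvd Suc (5 * N + i)" if "i < 4" for i
      using that by presburger
    then have n: "norm5 (p (Suc (5 * N + i))) = n i" if "i < 4" for i
      using that by (simp only: norm if_False n_def)
    have "norm5 (p (Suc (5 * N + 4))) = norm5 (p (5 * Suc N))"
      by simp
    then have n4: "norm5 (p (Suc (5 * N + 4))) = p (5 * Suc N) ^ 5"
      unfolding norm by simp
    have p25: "p (25 * Suc N) = n 4"
      by (simp add: n_def)
    have "(\<Prod>i<5 * Suc N. norm5 (p (Suc i))) * (\<Prod>i<Suc N. p (25 * Suc i))
      = P * (n 0 * n 1 * n 2 * n 3 * p (5 * Suc N) ^ 5) * (Q * n 4)"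
      using n[of 0] n[of 1] n[of 2] n[of 3]
      by (simp only: unroll n4 P_def[symmetric] prod.lessThan_Suc Q_def[symmetric] p25) simp
    also have "\<dots> = (P * Q) * (n 0 * n 1 * n 2 * n 3 * n 4) * p (5 * Suc N) ^ 5"
      by (simp only: mult_ac)
    also have "\<dots> = R * (n 0 * n 1 * n 2 * n 3 * n 4) * (S * p (5 * Suc N)) ^ 5"
      by (simp only: IH power_mult_distrib mult_ac)
    also have "\<dots> = (\<Prod>i<5 * Suc N. p (5 * Suc i)) * (\<Prod>i<Suc N. p (5 * Suc i)) ^ 5"
      by (simp only: unroll R_def[symmetric] S_def[symmetric] prod.lessThan_Suc n_def) simp
    finally show ?case .
  qed (simp add: p_def)
  also have "\<dots> = dilate5 (\<Prod>i<5 * N. p (Suc i)) * dilate5 (\<Prod>i<N. p (Suc i)) ^ 5"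
    by (simp add: dilate5_prod p_def dilate5_hom power_add flip: power_mult)
  also have "fps_cong N \<dots> (dilate5 euler_fps * dilate5 euler_fps ^ 5)"
  proof (intro fps_cong_mult)
    show "fps_cong N (dilate5 (\<Prod>i<5 * N. p (Suc i))) (dilate5 euler_fps)"
      by (intro dilate5_cong fps_cong_sym[OF euler_fps]) simp
    have "fps_cong N (\<Prod>i<5::nat. dilate5 (\<Prod>i<N. p (Suc i))) (\<Prod>i<5::nat. dilate5 euler_fps)"
      by (intro fps_cong_prod dilate5_cong fps_cong_sym[OF euler_fps]) simp
    then show "fps_cong N (dilate5 (\<Prod>i<N. p (Suc i)) ^ 5) (dilate5 euler_fps ^ 5)"
      by simp
  qed
  finally show "fps_cong N (norm5 euler_fps * dilate5 (dilate5 euler_fps)) (dilate5 euler_fps ^ 6)"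
    by (simp add: eval_nat_numeral mult.assoc)
qed

text \<open>The form factors as (y + kappa x)(y + kappa' x), and rescaling multiplies x by a fifth
  root of unity, so each linear factor has norm y^5 + kappa^5 x^5.\<close>

lemma norm5_theta:
  "norm5 (dilate5 theta_b ^ 2 - fps_X * dilate5 theta_a * dilate5 theta_b - fps_X ^ 2 * dilate5 theta_a ^ 2)
     = dilate5 (theta_b ^ 10 - 11 * fps_X * theta_a ^ 5 * theta_b ^ 5 - fps_X ^ 2 * theta_a ^ 10)"
proof -
  define k k' where "k = fps_const (z ^ 2 + z ^ 3)" and "k' = fps_const (z + z ^ 4)"
  define c where "c = fps_const z"
  have "fps_const (z ^ 4 + z ^ 3 + z ^ 2 + z + 1) = 0"
    by (simp add: z)
  then have c: "c ^ 4 + c ^ 3 + c ^ 2 + c + 1 = 0"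
    unfolding c_def by (simp add: fps_const_power flip: fps_const_add)
  have sum: "k + k' = - 1"
  proof -
    have "k + k' = (c ^ 4 + c ^ 3 + c ^ 2 + c + 1) - 1"
      by (simp add: k_def k'_def c_def fps_const_power flip: fps_const_add)
    then show ?thesis by (simp add: c)
  qed
  have mult: "k * k' = - 1"
  proof -
    have "(z ^ 2 + z ^ 3) * (z + z ^ 4) = (z ^ 2 + z ^ 3) + (z + z ^ 4)"
      by (simp add: algebra_simps z_reduce[OF z] flip: power_add power_Suc power_Suc2)
    then have "k * k' = k + k'"
      unfolding k_def k'_def by (simp only: fps_const_mult fps_const_add)
    with sum show ?thesis by simp
  qed
  have factor: "(y - (- k) * x) * (y - (- k') * x) = y ^ 2 - x * y - x ^ 2" for x y
  proof -
    have "(y - (- k) * x) * (y - (- k') * x) = y ^ 2 + (k + k') * (x * y) + (k * k') * x ^ 2"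
      by (simp add: algebra_simps power2_eq_square)
    then show ?thesis by (simp add: sum mult)
  qed
  define x y where "x = fps_X * dilate5 theta_a" and "y = dilate5 theta_b"
  have rx: "rescale (z ^ i) (y ^ 2 - x * y - x ^ 2) = (y - (- k * x) * c ^ i) * (y - (- k' * x) * c ^ i)" for i
  proof -
    have "(z ^ i) ^ 5 = 1"
      by (metis power_mult mult.commute power_one z5[OF z])
    then have "rescale (z ^ i) (y ^ 2 - x * y - x ^ 2) = y ^ 2 - (c ^ i * x) * y - (c ^ i * x) ^ 2"
      by (simp add: x_def y_def rescale_hom rescale_dilate5 c_def fps_const_power mult.assoc)
    also have "\<dots> = (y - (- k) * (c ^ i * x)) * (y - (- k') * (c ^ i * x))"
      by (rule factor[symmetric])
    finally show ?thesis by (simp add: mult_ac)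
  qed
  have "norm5 (y ^ 2 - x * y - x ^ 2)
     = ((y - (- k * x)) * (y - c * (- k * x)) * (y - c ^ 2 * (- k * x)) * (y - c ^ 3 * (- k * x)) * (y - c ^ 4 * (- k * x)))
     * ((y - (- k' * x)) * (y - c * (- k' * x)) * (y - c ^ 2 * (- k' * x)) * (y - c ^ 3 * (- k' * x)) * (y - c ^ 4 * (- k' * x)))"
    using factor[of y x, symmetric] rx[of 1] rx[of 2] rx[of 3] rx[of 4]
    unfolding norm5_def power_one_right by (simp only: mult_ac mult_minus_left mult_minus_right)
  also have "\<dots> = (y ^ 5 - (- k * x) ^ 5) * (y ^ 5 - (- k' * x) ^ 5)"
    by (simp only: prod_cyclotomic5[OF c])
  also have "\<dots> = y ^ 10 + (k ^ 5 + k' ^ 5) * (x ^ 5 * y ^ 5) + (k * k') ^ 5 * x ^ 10"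
    by (simp add: algebra_simps power_mult_distrib flip: power_add)
  \<comment> \<open>With k + k' = k k' = -1 the right side is -1 - 5 - 5 = -11.\<close>
  also have "k ^ 5 + k' ^ 5 = (k + k') ^ 5 - 5 * (k * k') * (k + k') ^ 3 + 5 * (k * k') ^ 2 * (k + k')"
    by (simp add: algebra_simps eval_nat_numeral)
  finally show ?thesis
    by (simp add: sum mult x_def y_def dilate5_hom power_mult_distrib mult.assoc flip: power_mult)
qed

end

text \<open>The norm of \<open>euler_fps_mod5\<close>: the exponent 11 is 6 from
  \<open>norm5_euler_fps\<close> plus 5 from the factor that is already a series in q^5.\<close>

lemma euler_fps_eleventh: "(theta_b ^ 10 - 11 * fps_X * theta_a ^ 5 * theta_b ^ 5 - fps_X ^ 2 * theta_a ^ 10) * dilate5 euler_fps = euler_fps ^ 11"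
proof -
  obtain z :: complex where z: "z ^ 4 + z ^ 3 + z ^ 2 + z + 1 = 0"
    using ex_cyclotomic5 by blast
  have "dilate5 ((theta_b ^ 10 - 11 * fps_X * theta_a ^ 5 * theta_b ^ 5 - fps_X ^ 2 * theta_a ^ 10) * dilate5 euler_fps)
     = norm5 z (euler_fps * dilate5 euler_fps) * dilate5 (dilate5 euler_fps)"
    unfolding euler_fps_mod5 norm5_theta[OF z] dilate5_hom(4) ..
  also have "\<dots> = (norm5 z euler_fps * dilate5 (dilate5 euler_fps)) * dilate5 euler_fps ^ 5"
    by (simp only: norm5_mult[OF z] norm5_dilate5[OF z] mult_ac)
  also have "\<dots> = dilate5 (euler_fps ^ 11)"
    unfolding norm5_euler_fps[OF z] by (simp add: dilate5_hom flip: power_add)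
  finally show ?thesis by (rule dilate5_inj)
qed

section \<open>Every fifth coefficient\<close>

lemma section5_0_X_power_dilate5: "section5 0 (fps_X ^ k * dilate5 f) = (if 5 dvd k then fps_X ^ (k div 5) * f else (0 :: complex fps))"
proof -
  have "fps_X ^ k * dilate5 f = fps_X ^ (k mod 5) * dilate5 (fps_X ^ (k div 5) * f)"
    by (simp add: dilate5_hom flip: power_mult power_add mult.assoc)
  then show ?thesis
    by (simp add: section5_dilate5 dvd_eq_mod_eq_0 eq_commute[of 0])
qed

lemma section5_sum: "section5 r (sum f A) = (\<Sum>i\<in>A. section5 r (f i))"
  by (simp add: section5_def fps_eq_iff fps_sum_nth)

lemma sum_section5: "(\<Sum>r<5. fps_X ^ r * dilate5 (section5 r f)) = f"
proof -
  have "(\<Sum>r<5. fps_nth (fps_X ^ r * dilate5 (section5 r f)) n) = (\<Sum>r<5. if r = n mod 5 then fps_nth f n else 0)" for n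
  proof (intro sum.cong refl)
    fix r assume "r \<in> {..<5::nat}"
    then have "n \<ge> r \<and> 5 dvd n - r \<longleftrightarrow> r = n mod 5"
      using mod_eq_dvd_iff_nat[of r n 5] by (cases "r \<le> n") auto
    then show "fps_nth (fps_X ^ r * dilate5 (section5 r f)) n = (if r = n mod 5 then fps_nth f n else 0)"
      by (auto simp: fps_X_power_mult_nth dilate5_nth section5_def not_less)
  qed
  then show ?thesis
    by (simp add: fps_eq_iff fps_sum_nth)
qed

lemma section5_dilate5_mult: "r < 5 \<Longrightarrow> section5 r (dilate5 f * g) = f * section5 r (g :: 'a::idom fps)"
proof -
  assume "r < 5"
  have "dilate5 f * g = (\<Sum>s<5. fps_X ^ s * dilate5 (f * section5 s g))"
    by (subst sum_section5[of g, symmetric]) (simp add: dilate5_hom sum_distrib_left mult_ac)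
  then show ?thesis
    using \<open>r < 5\<close> by (simp add: section5_sum section5_dilate5 sum.delta)
qed

section \<open>The finite Fourier expansion of chi\<close>

definition chi :: "int \<Rightarrow> complex" where
  "chi k = (if k mod 5 = 1 then 1 else if k mod 5 = 2 then 2 else if k mod 5 = 3 then - 2
     else if k mod 5 = 4 then - 1 else 0)"

lemma chi_minus: "chi (- k) = - chi k"
proof -
  have "k mod 5 \<in> {0, 1, 2, 3, 4}" by auto
  then show ?thesis
    unfolding chi_def zmod_zminus1_eq_if by auto
qed

abbreviation NB_gf :: "complex fps" where
  "NB_gf \<equiv> Abs_fps (\<lambda>n. of_nat (NB 3 1 5 n) - of_nat (NB 3 4 5 n) + 2 * of_nat (NB 3 2 5 n) - 2 * of_nat (NB 3 3 5 n))"

lemma NB_gf_nth: "fps_nth NB_gf n = (\<Sum>ps\<in>colored_partitions 3 n. of_nat (size (ps ! 0)) * chi (crank ps))"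
proof -
  have NB: "of_nat (NB 3 m 5 n) = (\<Sum>ps\<in>colored_partitions 3 n.
      if crank ps mod 5 = int m mod 5 then of_nat (size (ps ! 0)) else (0 :: complex))" for m
    unfolding NB_def cong_def by (simp add: sum.inter_filter[OF finite_colored_partitions, symmetric] if_distrib)
  show ?thesis
    unfolding fps_nth_Abs_fps NB sum_distrib_left sum.distrib[symmetric] sum_subtractf[symmetric]
    by (intro sum.cong refl) (simp add: chi_def)
qed

lemma two_NB_gf: "2 * fps_nth NB_gf n = (\<Sum>ps\<in>colored_partitions 3 n. of_int (crank ps) * chi (crank ps))"
proof -
  define sw :: "nat multiset list \<Rightarrow> nat multiset list" where "sw ps = [ps ! 1, ps ! 0, ps ! 2]" for ps
  have sw: "sw ps \<in> colored_partitions 3 n" "sw (sw ps) = ps" "crank (sw ps) = - crank ps" "sw ps ! 0 = ps ! 1"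
    if "ps \<in> colored_partitions 3 n" for ps
    using that by (auto simp: sw_def colored_partitions_def crank_def numeral_3_eq_3 length_Suc_conv)
  have "(\<Sum>ps\<in>colored_partitions 3 n. of_nat (size (ps ! 0)) * chi (crank ps))
      = (\<Sum>ps\<in>colored_partitions 3 n. of_nat (size (sw ps ! 0)) * chi (crank (sw ps)))"
    by (rule sum.reindex_bij_witness[of _ sw sw]) (simp_all add: sw)
  also have "\<dots> = (\<Sum>ps\<in>colored_partitions 3 n. - (of_nat (size (ps ! 1)) * chi (crank ps)))"
    by (intro sum.cong refl) (simp add: sw chi_minus)
  finally have "2 * fps_nth NB_gf n = (\<Sum>ps\<in>colored_partitions 3 n. of_nat (size (ps ! 0)) * chi (crank ps))
     + (\<Sum>ps\<in>colored_partitions 3 n. - (of_nat (size (ps ! 1)) * chi (crank ps)))"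
    unfolding NB_gf_nth by simp
  then show ?thesis
    by (simp add: crank_def left_diff_distrib sum_subtractf sum_negf)
qed

lemma zpow_mod: "y ^ 5 = 1 \<Longrightarrow> zpow y (y ^ 4) k = (y :: complex) ^ nat (k mod 5)"
proof -
  assume y: "y ^ 5 = 1"
  then have "y \<noteq> 0" by auto
  have y4: "y ^ 4 = inverse y"
    using y by (intro inverse_unique[symmetric]) (simp flip: power_Suc)
  have "zpow y (y ^ 4) k = y powi (5 * (k div 5) + k mod 5)"
    by (simp add: y4 zpow_def power_int_def)
  also have "\<dots> = y powi (k mod 5)"
  proof -
    have "y powi (5 * (k div 5) + k mod 5) = y powi (5 * (k div 5)) * y powi (k mod 5)"
      using \<open>y \<noteq> 0\<close> by (intro power_int_add) auto
    also have "y powi (5 * (k div 5)) = 1"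
      using y by (simp only: power_int_mult power_int_numeral power_int_1_left)
    finally show ?thesis by simp
  qed
  finally show ?thesis by (simp add: power_int_def)
qed

text \<open>For y^5 = 1 this is the Fourier coefficient y^4 + 2 y^3 - 2 y^2 - y of
  \<open>chi\<close>. The factor 1 - y^4 is split off to match the one in front of T^2 F' in
  \<open>crank_gf'_mult_theta_prod\<close>.\<close>

definition chi_hat :: "complex \<Rightarrow> complex" where
  "chi_hat y = (1 - y ^ 4) * (y ^ 4 + 3 * y ^ 3 + y ^ 2)"

lemma sum_le_8: "(\<Sum>m\<le>8. f m) = f 0 + f 1 + f 2 + f 3 + f 4 + f 5 + f 6 + f 7 + f (8 :: nat)"
  for f :: "nat \<Rightarrow> 'a::comm_monoid_add"
  by (simp add: eval_nat_numeral)

lemma sum_1234: "(\<Sum>j\<in>{1, 2, 3, 4}. f j) = f 1 + f 2 + f 3 + f (4 :: nat)"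
  for f :: "nat \<Rightarrow> 'a::comm_monoid_add"
  by (simp add: add.assoc)

context
  fixes z :: complex
  assumes z: "z ^ 4 + z ^ 3 + z ^ 2 + z + 1 = 0"
begin

lemma power_root: "(z ^ j) ^ 5 = 1"
  by (metis power_mult mult.commute power_one z5[OF z])

text \<open>The index j = 0 is absent because the values of \<open>chi\<close> add up to 0.\<close>

lemma chi_fourier:
  "5 * chi k = (\<Sum>j\<in>{1, 2, 3, 4}. chi_hat (z ^ j) * zpow (z ^ j) ((z ^ j) ^ 4) k)"
proof -
  have chi_hat: "chi_hat y = y ^ 4 + 2 * y ^ 3 - 2 * y ^ 2 - y" if "y ^ 5 = 1" for y
    using that unfolding chi_hat_def by algebra
  have "k mod 5 \<in> {0, 1, 2, 3, 4}" by auto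
  then have "nat (k mod 5) \<in> {0, 1, 2, 3, 4} \<and> k mod 5 = int (nat (k mod 5))" by auto
  then obtain i where i: "i \<in> {0, 1, 2, 3, 4}" "k mod 5 = int i" "nat (k mod 5) = i" by blast
  have "(\<Sum>j\<in>{1, 2, 3, 4}. chi_hat (z ^ j) * zpow (z ^ j) ((z ^ j) ^ 4) k)
      = (\<Sum>j\<in>{1, 2, 3, 4}. ((z ^ j) ^ 4 + 2 * (z ^ j) ^ 3 - 2 * (z ^ j) ^ 2 - z ^ j) * (z ^ j) ^ i)"
    by (simp only: zpow_mod[OF power_root] i nat_int chi_hat[OF power_root])
  also have "\<dots> = (z ^ 4 + 2 * z ^ 3 - 2 * z ^ 2 - z) * z ^ i
      + ((z ^ 2) ^ 4 + 2 * (z ^ 2) ^ 3 - 2 * (z ^ 2) ^ 2 - z ^ 2) * (z ^ 2) ^ i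
      + ((z ^ 3) ^ 4 + 2 * (z ^ 3) ^ 3 - 2 * (z ^ 3) ^ 2 - z ^ 3) * (z ^ 3) ^ i
      + ((z ^ 4) ^ 4 + 2 * (z ^ 4) ^ 3 - 2 * (z ^ 4) ^ 2 - z ^ 4) * (z ^ 4) ^ i"
    by (simp only: sum_1234 power_one_right)
  also have "\<dots> = 5 * chi k"
  proof -
    define f where "f i = (z ^ 4 + 2 * z ^ 3 - 2 * z ^ 2 - z) * z ^ i
      + ((z ^ 2) ^ 4 + 2 * (z ^ 2) ^ 3 - 2 * (z ^ 2) ^ 2 - z ^ 2) * (z ^ 2) ^ i
      + ((z ^ 3) ^ 4 + 2 * (z ^ 3) ^ 3 - 2 * (z ^ 3) ^ 2 - z ^ 3) * (z ^ 3) ^ i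
      + ((z ^ 4) ^ 4 + 2 * (z ^ 4) ^ 3 - 2 * (z ^ 4) ^ 2 - z ^ 4) * (z ^ 4) ^ i" for i :: nat
    have "f 0 = 0" using z unfolding f_def power_0 by algebra
    moreover have "f 1 = 5" using z unfolding f_def power_one_right by algebra
    moreover have "f 2 = 10" "f 3 = - 10" "f 4 = - 5" using z unfolding f_def by algebra+
    moreover have "chi k = (if i = 1 then 1 else if i = 2 then 2 else if i = 3 then - 2 else if i = 4 then - 1 else 0)"
      using i(1) unfolding chi_def i(2) by auto
    ultimately have "f i = 5 * chi k"
      using i(1) by auto
    then show ?thesis by (simp only: f_def)
  qed
  finally show ?thesis ..
qed

text \<open>The factor 10 combines the 2 of the involution in \<open>two_NB_gf\<close> with the 5 of
  \<open>chi_fourier\<close>.\<close>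

lemma NB_gf_eq:
  "10 * NB_gf = (\<Sum>j\<in>{1, 2, 3, 4}. fps_const (chi_hat (z ^ j)) * crank_gf' (z ^ j) ((z ^ j) ^ 4))"
proof (rule fps_ext)
  fix n
  have "fps_nth (10 * NB_gf) n = 5 * (2 * fps_nth NB_gf n)"
    by (simp add: numeral_fps_const del: fps_const_mult)
  also have "\<dots> = (\<Sum>ps\<in>colored_partitions 3 n. of_int (crank ps) * (5 * chi (crank ps)))"
    unfolding two_NB_gf by (simp add: sum_distrib_left mult_ac)
  also have "\<dots> = (\<Sum>j\<in>{1, 2, 3, 4}. \<Sum>ps\<in>colored_partitions 3 n.
      chi_hat (z ^ j) * (of_int (crank ps) * zpow (z ^ j) ((z ^ j) ^ 4) (crank ps)))"
    unfolding chi_fourier by (subst sum.swap) (simp only: sum_distrib_left mult_ac)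
  also have "\<dots> = fps_nth (\<Sum>j\<in>{1, 2, 3, 4}. fps_const (chi_hat (z ^ j)) * crank_gf' (z ^ j) ((z ^ j) ^ 4)) n"
    by (simp only: fps_sum_nth fps_mult_left_const_nth crank_gf'_def fps_nth_Abs_fps sum_distrib_left)
  finally show "fps_nth (10 * NB_gf) n
     = fps_nth (\<Sum>j\<in>{1, 2, 3, 4}. fps_const (chi_hat (z ^ j)) * crank_gf' (z ^ j) ((z ^ j) ^ 4)) n" .
qed

end

text \<open>
  With p = b^5, r = q a^5, e = E1^3 and y = z, the polynomial below is the numerator of the section of F'(z);
  the powers of kappa = y^2 + y^3 are reduced by kappa^2 = 1 - kappa. Adding the contributions of y and 1/y,
  which share kappa, leaves psi.
\<close>

definition phi :: "'a::comm_ring_1 \<Rightarrow> 'a \<Rightarrow> 'a \<Rightarrow> 'a \<Rightarrow> 'a" where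
  "phi y p r e = (let k = y ^ 2 + y ^ 3 in
     (p - 3 * r - e) * (- (1 + y ^ 4)) * (p - 4 * (5 * k - 3) * r)
      + (2 * (2 * y + y ^ 2 + 2 * y ^ 3) * e + (y + y ^ 3) * (3 * p + r - 3 * e)) * (5 * (2 - 3 * k) * r)
      - 10 * y ^ 2 * (3 * (1 - k) * p * r - 2 * (13 * k - 8) * r ^ 2))"

definition psi :: "'a::comm_ring_1 \<Rightarrow> 'a \<Rightarrow> 'a \<Rightarrow> 'a \<Rightarrow> 'a" where
  "psi k p r e = p ^ 2 * (1 - 3 * k) + p * r * (39 - 92 * k) + r ^ 2 * (1253 * k - 776)
      + r * e * (18 - 29 * k) + p * e * (3 * k - 1)"

text \<open>The weights are \<open>chi_hat\<close> without its factor 1 - y^4, at y and at y^4 =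
  1/y.\<close>

lemma phi_pair:
  fixes y :: "'a::idom"
  assumes y: "y ^ 4 + y ^ 3 + y ^ 2 + y + 1 = 0"
  shows "(y ^ 4 + 3 * y ^ 3 + y ^ 2) * phi y p r e + (y + 3 * y ^ 2 + y ^ 3) * phi (y ^ 4) p r e
    = 2 * psi (y ^ 2 + y ^ 3) p r e"
proof -
  \<comment> \<open>Sorted by monomials in p, r, e, the claim becomes five identities in y alone,
    small enough for \<open>algebra\<close>.\<close>
  have phi: "phi y p r e = p ^ 2 * (- (1 + y ^ 4))
      + p * r * ((1 + y ^ 4) * (20 * (y ^ 2 + y ^ 3) - 9) + 15 * (y + y ^ 3) * (2 - 3 * (y ^ 2 + y ^ 3))
          - 30 * y ^ 2 * (1 - (y ^ 2 + y ^ 3)))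
      + r ^ 2 * (- 12 * (1 + y ^ 4) * (5 * (y ^ 2 + y ^ 3) - 3) + 5 * (y + y ^ 3) * (2 - 3 * (y ^ 2 + y ^ 3))
          + 20 * y ^ 2 * (13 * (y ^ 2 + y ^ 3) - 8))
      + r * e * (- 4 * (1 + y ^ 4) * (5 * (y ^ 2 + y ^ 3) - 3) + 5 * (2 - 3 * (y ^ 2 + y ^ 3)) * (y + 2 * y ^ 2 + y ^ 3))
      + p * e * (1 + y ^ 4)" for y :: 'a
  proof -
    define k s where "k = y ^ 2 + y ^ 3" and "s = 1 + y ^ 4"
    show ?thesis
      unfolding phi_def Let_def k_def[symmetric] s_def[symmetric]
      by (simp add: algebra_simps power2_eq_square)
  qed
  have lin: "g * (p ^ 2 * a1 + p * r * a2 + r ^ 2 * a3 + r * e * a4 + p * e * a5)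
      + g' * (p ^ 2 * b1 + p * r * b2 + r ^ 2 * b3 + r * e * b4 + p * e * b5)
    = p ^ 2 * (g * a1 + g' * b1) + p * r * (g * a2 + g' * b2) + r ^ 2 * (g * a3 + g' * b3)
      + r * e * (g * a4 + g' * b4) + p * e * (g * a5 + g' * b5)" for g g' a1 a2 a3 a4 a5 b1 b2 b3 b4 b5 :: 'a
    by (simp add: algebra_simps)
  have lin2: "2 * psi k p r e = p ^ 2 * (2 * (1 - 3 * k)) + p * r * (2 * (39 - 92 * k)) + r ^ 2 * (2 * (1253 * k - 776))
      + r * e * (2 * (18 - 29 * k)) + p * e * (2 * (3 * k - 1))" for k
    by (simp add: psi_def algebra_simps)
  show ?thesis
    unfolding phi lin lin2
    by (intro arg_cong2[of _ _ _ _ "(+)"] arg_cong2[of _ _ _ _ "(*)"] refl; use y in algebra)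
qed
text \<open>Since 5 k - 3 is the fifth power of k, the squares are the complementary denominators.
  The norm form splits off on the right, which is why N and not N^2 stays in the
  denominator.\<close>

lemma psi_pair:
  fixes k :: "'a::idom"
  assumes k: "k + k' = - 1" "k * k' = - 1"
  shows "(p + (5 * k' - 3) * r) ^ 2 * psi k p r e + (p + (5 * k - 3) * r) ^ 2 * psi k' p r e
     = 5 * ((p ^ 2 - 11 * p * r - r ^ 2) * (p ^ 2 + 49 * p * r + 44 * r ^ 2 - (p + 2 * r) * e))"
  using k unfolding psi_def by algebra

lemma cyclotomic5_const:
  fixes z :: complex
  assumes "z ^ 4 + z ^ 3 + z ^ 2 + z + 1 = 0"
  shows "fps_const z ^ 4 + fps_const z ^ 3 + fps_const z ^ 2 + fps_const z + 1 = 0"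
  using assms by (metis fps_const_0_eq_0 fps_const_1_eq_1 fps_const_add fps_const_power)

section \<open>The section of F' and the sum over the roots of unity\<close>

text \<open>The quotient rule without a quotient: \<open>crank_gf'_theta\<close> is multiplied by T,
  and F T = 1 removes F.\<close>

lemma crank_gf'_mult_theta_prod:
  fixes z :: complex
  assumes z: "z ^ 4 + z ^ 3 + z ^ 2 + z + 1 = 0"
  shows "fps_const (1 - z ^ 4) * theta_prod z (z ^ 4) ^ 2 * crank_gf' z (z ^ 4)
    = fps_const (z ^ 4) * theta_prod z (z ^ 4) - theta' z (z ^ 4)"
proof -
  have zz: "z * z ^ 4 = 1"
    using z5[OF z] by (simp flip: power_Suc)
  define T where "T = theta_prod z (z ^ 4)"
  have T: "crank_gf z (z ^ 4) * T = 1"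
    unfolding T_def theta_prod_def by (rule crank_gf_qpoch_inf[OF zz])
  have "crank_gf' z (z ^ 4) * (fps_const (1 - z ^ 4) * T) = fps_const (z ^ 4) - crank_gf z (z ^ 4) * theta' z (z ^ 4)"
    using crank_gf'_theta[OF zz] theta_eq_theta_prod[OF z] by (simp only: T_def eq_diff_eq)
  then have "crank_gf' z (z ^ 4) * (fps_const (1 - z ^ 4) * T) * T
     = fps_const (z ^ 4) * T - (crank_gf z (z ^ 4) * T) * theta' z (z ^ 4)"
    by (simp only: left_diff_distrib right_diff_distrib mult_ac)
  then show ?thesis
    unfolding T mult_1 T_def[symmetric] power2_eq_square by (simp only: mult_ac)
qed

text \<open>The cofactor R turns T into a series in q^5, whose square can be taken out of the
  section, so that only a polynomial numerator has to be dissected. The factors 2 and E1^3 are there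
  because a' and b' are known only through 10 a' E1^3 and 10 b' E1^3.\<close>

lemma section5_crank_gf':
  fixes z :: complex
  assumes z: "z ^ 4 + z ^ 3 + z ^ 2 + z + 1 = 0"
  defines "c \<equiv> fps_const z"
  shows "2 * (1 - c ^ 4) * (theta_b ^ 5 + (5 * (c ^ 2 + c ^ 3) - 3) * (fps_X * theta_a ^ 5)) ^ 2
      * section5 0 (crank_gf' z (z ^ 4)) * euler_fps ^ 3
    = theta_b ^ 4 * phi c (theta_b ^ 5) (fps_X * theta_a ^ 5) (euler_fps ^ 3)"
proof -
  define k where "k = c ^ 2 + c ^ 3"
  have c: "c ^ 4 + c ^ 3 + c ^ 2 + c + 1 = 0"
    unfolding c_def by (rule cyclotomic5_const[OF z])
  have k2: "k ^ 2 = 1 - k"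
    using c unfolding k_def by algebra
  \<comment> \<open>Up to sign the coefficients are Fibonacci numbers; with \<open>k2\<close> these
    are the powers that survive the section.\<close>
  have k4: "k ^ 4 = 2 - 3 * k" and k5: "k ^ 5 = 5 * k - 3" and k7: "k ^ 7 = 13 * k - 8"
    using k2 by algebra+
  have const: "fps_const (1 - z ^ 4) = 1 - c ^ 4" "fps_const (z ^ 4) = c ^ 4"
    "fps_const (z ^ 2 + z ^ 3) = k" "fps_const (5 * (1 + z ^ 4)) = 5 * (1 + c ^ 4)"
    "fps_const (z + 2 * z ^ 3) = c + 2 * c ^ 3" "fps_const (5 * (z + z ^ 3)) = 5 * (c + c ^ 3)"
    "fps_const (5 * z ^ 2) = 5 * c ^ 2"
    by (simp_all add: c_def k_def fps_const_power numeral_fps_const flip: fps_const_add fps_const_sub fps_const_mult)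
  have dilate5_c: "dilate5 c = c" "dilate5 k = k"
    by (simp_all add: k_def dilate5_hom) (simp_all add: c_def dilate5_hom)
  define a b J where "a = theta_a" and "b = theta_b" and "J = dilate5 euler_fps ^ 3"
  define D where "D = crank_gf' z (z ^ 4)"
  define M where "M = b ^ 5 + k ^ 5 * (fps_X * a ^ 5)"
  \<comment> \<open>Components of the numerator T / z - theta' in the classes 0, 1, 3; the
    unweighted \<open>theta_b\<close> cancels in class 0.\<close>
  define W0 W1 W3 where "W0 = - 5 * (1 + c ^ 4) * theta_b'"
    and "W1 = (2 * c + c ^ 2 + 2 * c ^ 3) * a + 5 * (c + c ^ 3) * theta_a'" and "W3 = - 5 * c ^ 2 * J"
  define R where "R = (\<Sum>i<5. (- k) ^ i * (fps_X * dilate5 a) ^ i * dilate5 b ^ (4 - i))"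
  have T: "theta_prod z (z ^ 4) = dilate5 b + k * fps_X * dilate5 a"
    unfolding theta_prod_mod5[OF z] const a_def b_def ..
  have TR: "theta_prod z (z ^ 4) * R = dilate5 M"
    unfolding T R_def M_def by (simp add: dilate5_hom dilate5_c eval_nat_numeral algebra_simps)
  have W: "c ^ 4 * theta_prod z (z ^ 4) - theta' z (z ^ 4) = dilate5 W0 + fps_X * dilate5 W1 + fps_X ^ 3 * dilate5 W3"
  proof -
    have "c ^ 4 * k = c + c ^ 2"
      using c unfolding k_def by algebra
    then have "c ^ 4 * theta_prod z (z ^ 4) = c ^ 4 * dilate5 b + (c + c ^ 2) * fps_X * dilate5 a"
      unfolding T by (simp only: distrib_left mult.assoc[symmetric])
    then show ?thesis
      unfolding theta'_mod5[OF z5[OF z]] const W0_def W1_def W3_def J_def a_def b_def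
      by (simp add: dilate5_hom dilate5_c algebra_simps)
  qed
  \<comment> \<open>The numbers \<open>min (m + 1) (9 - m)\<close> are the coefficients of (1 + t +
    t^2 + t^3 + t^4)^2.\<close>
  define g where "g m = of_nat (min (m + 1) (9 - m)) * (- k) ^ m * a ^ m * b ^ (8 - m)" for m
  have R2: "R ^ 2 = (\<Sum>m\<le>8. fps_X ^ m * dilate5 (g m))"
  proof -
    have square: "(\<Sum>i<5. t ^ i * y ^ (4 - i)) ^ 2 = (\<Sum>m\<le>8. of_nat (min (m + 1) (9 - m)) * t ^ m * y ^ (8 - m))"
      for t y :: "complex fps"
      by (simp add: eval_nat_numeral algebra_simps)
    have "dilate5 (of_nat n :: complex fps) = of_nat n" for n
      by (simp add: dilate5_hom flip: fps_of_nat)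
    then have "fps_X ^ m * dilate5 (g m) = of_nat (min (m + 1) (9 - m)) * ((- k) * (fps_X * dilate5 a)) ^ m * dilate5 b ^ (8 - m)" for m
      unfolding g_def dilate5_hom by (simp only: dilate5_c power_mult_distrib mult_ac)
    then show ?thesis
      unfolding R_def power_mult_distrib[symmetric] square by simp
  qed
  have "dilate5 (M ^ 2) * ((1 - c ^ 4) * D) = ((1 - c ^ 4) * theta_prod z (z ^ 4) ^ 2 * D) * R ^ 2"
    unfolding dilate5_hom TR[symmetric] by (simp only: power_mult_distrib mult_ac)
  also have "\<dots> = (dilate5 W0 + fps_X * dilate5 W1 + fps_X ^ 3 * dilate5 W3) * R ^ 2"
    using crank_gf'_mult_theta_prod[OF z] W unfolding const D_def by simp
  also have "\<dots> = (\<Sum>m\<le>8. fps_X ^ m * dilate5 (W0 * g m) + fps_X ^ (m + 1) * dilate5 (W1 * g m) + fps_X ^ (m + 3) * dilate5 (W3 * g m))"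
    unfolding R2 sum_distrib_left by (intro sum.cong refl) (simp add: dilate5_hom power_add algebra_simps)
  finally have "section5 0 (dilate5 (M ^ 2) * (dilate5 (1 - c ^ 4) * D))
     = (\<Sum>m\<le>8. section5 0 (fps_X ^ m * dilate5 (W0 * g m)) + section5 0 (fps_X ^ (m + 1) * dilate5 (W1 * g m))
          + section5 0 (fps_X ^ (m + 3) * dilate5 (W3 * g m)))"
    by (simp only: section5_sum section5_add dilate5_hom dilate5_c)
  \<comment> \<open>For m up to 8, the exponents m, m + 1 and m + 3 are divisible by 5 only for m =
    0, 5, for m = 4, and for m = 2, 7 respectively.\<close>
  also have "\<dots> = W0 * g 0 + fps_X * (W0 * g 5) + fps_X * (W1 * g 4) + fps_X * (W3 * g 2) + fps_X ^ 2 * (W3 * g 7)"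
    unfolding section5_0_X_power_dilate5 sum_le_8 by (simp flip: numeral_2_eq_2)
  finally have H: "M ^ 2 * ((1 - c ^ 4) * section5 0 D)
     = W0 * g 0 + fps_X * (W0 * g 5) + fps_X * (W1 * g 4) + fps_X * (W3 * g 2) + fps_X ^ 2 * (W3 * g 7)"
    by (simp only: section5_dilate5_mult zero_less_numeral)
  have g: "g 0 = b ^ 8" "g 5 = - 4 * k ^ 5 * a ^ 5 * b ^ 3" "g 4 = 5 * k ^ 4 * a ^ 4 * b ^ 4"
    "g 2 = 3 * k ^ 2 * a ^ 2 * b ^ 6" "g 7 = - 2 * k ^ 7 * a ^ 7 * b"
    by (simp_all add: g_def)
  define p r e where "p = b ^ 5" and "r = fps_X * a ^ 5" and "e = euler_fps ^ 3"
  have S: "10 * theta_b' * e = b * (p - 3 * r - e)"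
    using theta_b'_eq unfolding a_def[symmetric] b_def[symmetric] e_def[symmetric] p_def r_def by algebra
  have S': "10 * theta_a' * e = a * (3 * p + r - 3 * e)"
    using theta_a'_eq unfolding a_def[symmetric] b_def[symmetric] e_def[symmetric] p_def r_def by algebra
  have Je: "J * e = a ^ 3 * b ^ 3"
    using theta_a_theta_b by (simp add: J_def e_def a_def b_def mult.commute flip: power_mult_distrib)
  have W0e: "2 * W0 * e = - (1 + c ^ 4) * (b * (p - 3 * r - e))"
    unfolding W0_def S[symmetric] by (simp add: algebra_simps)
  have W1e: "2 * W1 * e = a * (2 * (2 * c + c ^ 2 + 2 * c ^ 3) * e + (c + c ^ 3) * (3 * p + r - 3 * e))"
  proof -
    have "2 * W1 * e = a * (2 * (2 * c + c ^ 2 + 2 * c ^ 3) * e) + (c + c ^ 3) * (10 * theta_a' * e)"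
      unfolding W1_def by (simp add: algebra_simps)
    then show ?thesis unfolding S' by (simp only: distrib_left mult_ac)
  qed
  have W3e: "2 * W3 * e = - 10 * c ^ 2 * (a ^ 3 * b ^ 3)"
    unfolding W3_def Je[symmetric] by simp
  have "2 * (1 - c ^ 4) * M ^ 2 * section5 0 D * e = 2 * e * (M ^ 2 * ((1 - c ^ 4) * section5 0 D))"
    by (simp only: mult_ac)
  also have "\<dots> = (2 * W0 * e) * (g 0 + fps_X * g 5) + (2 * W1 * e) * (fps_X * g 4) + (2 * W3 * e) * (fps_X * g 2 + fps_X ^ 2 * g 7)"
    unfolding H by (simp only: distrib_left mult_ac add.assoc)
  also have "\<dots> = b ^ 4 * phi c p r e"
    unfolding W0e W1e W3e g phi_def Let_def k_def[symmetric] k5 k4 k7 k2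
  proof -
    have ring: "(- s) * (b * P) * (b ^ 8 + fps_X * (- 4 * l5 * a ^ 5 * b ^ 3)) + a * Y * (fps_X * (5 * l4 * a ^ 4 * b ^ 4))
       + (- 10 * d * (a ^ 3 * b ^ 3)) * (fps_X * (3 * l2 * a ^ 2 * b ^ 6) + fps_X ^ 2 * (- 2 * l7 * a ^ 7 * b))
     = b ^ 4 * (P * (- s) * (b ^ 5 - 4 * l5 * (fps_X * a ^ 5)) + Y * (5 * l4 * (fps_X * a ^ 5))
         - 10 * d * (3 * l2 * b ^ 5 * (fps_X * a ^ 5) - 2 * l7 * (fps_X * a ^ 5) ^ 2))"
      for s P Y d l2 l4 l5 l7
      by (simp add: algebra_simps eval_nat_numeral)
    show "- (1 + c ^ 4) * (b * (p - 3 * r - e)) * (b ^ 8 + fps_X * (- 4 * (5 * k - 3) * a ^ 5 * b ^ 3)) +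
      a * (2 * (2 * c + c ^ 2 + 2 * c ^ 3) * e + (c + c ^ 3) * (3 * p + r - 3 * e)) * (fps_X * (5 * (2 - 3 * k) * a ^ 4 * b ^ 4)) +
      - 10 * c ^ 2 * (a ^ 3 * b ^ 3) * (fps_X * (3 * (1 - k) * a ^ 2 * b ^ 6) + fps_X ^ 2 * (- 2 * (13 * k - 8) * a ^ 7 * b))
      = b ^ 4 * ((p - 3 * r - e) * - (1 + c ^ 4) * (p - 4 * (5 * k - 3) * r) +
         (2 * (2 * c + c ^ 2 + 2 * c ^ 3) * e + (c + c ^ 3) * (3 * p + r - 3 * e)) * (5 * (2 - 3 * k) * r) -
         10 * c ^ 2 * (3 * (1 - k) * p * r - 2 * (13 * k - 8) * r ^ 2))"
      using ring[of "1 + c ^ 4" "p - 3 * r - e" "5 * k - 3"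
        "2 * (2 * c + c ^ 2 + 2 * c ^ 3) * e + (c + c ^ 3) * (3 * p + r - 3 * e)" "2 - 3 * k" "c ^ 2" "1 - k" "13 * k - 8",
        folded p_def r_def] .
  qed
  finally show ?thesis
    unfolding M_def k5 D_def a_def b_def p_def r_def e_def unfolding k_def .
qed

text \<open>z and z^4 share the denominator M(k), z^2 and z^3 share M(k'). After multiplication by
  N^2 = M(k)^2 M(k')^2 each pair keeps the square of the other M, which is the shape of
  \<open>psi_pair\<close>.\<close>

lemma section5_NB_gf:
  defines "p \<equiv> theta_b ^ 5" and "r \<equiv> fps_X * theta_a ^ 5" and "e \<equiv> euler_fps ^ 3"
  shows "2 * section5 0 NB_gf * (p ^ 2 - 11 * p * r - r ^ 2) * e
     = theta_b ^ 4 * (p ^ 2 + 49 * p * r + 44 * r ^ 2 - (p + 2 * r) * e)"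
proof -
  obtain z :: complex where z: "z ^ 4 + z ^ 3 + z ^ 2 + z + 1 = 0"
    using ex_cyclotomic5 by blast
  define c where "c = fps_const z"
  have c: "c ^ 4 + c ^ 3 + c ^ 2 + c + 1 = 0"
    unfolding c_def by (rule cyclotomic5_const[OF z])
  define k k' where "k = c ^ 2 + c ^ 3" and "k' = c + c ^ 4"
  have kk': "k + k' = - 1" "k * k' = - 1"
    using c unfolding k_def k'_def by algebra+
  define M where "M l = p + (5 * l - 3) * r" for l
  define N where "N = p ^ 2 - 11 * p * r - r ^ 2"
  have N: "M k * M k' = N"
    using kk' unfolding M_def N_def by algebra
  define G where "G y = y ^ 4 + 3 * y ^ 3 + y ^ 2" for y :: "complex fps"
  define H where "H j = section5 0 (crank_gf' (z ^ j) ((z ^ j) ^ 4))" for j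
  have H: "2 * (1 - (c ^ j) ^ 4) * M ((c ^ j) ^ 2 + (c ^ j) ^ 3) ^ 2 * H j * e = theta_b ^ 4 * phi (c ^ j) p r e"
    if "(z ^ j) ^ 4 + (z ^ j) ^ 3 + (z ^ j) ^ 2 + z ^ j + 1 = 0" for j
    using section5_crank_gf'[OF that] unfolding M_def H_def c_def p_def r_def e_def fps_const_power .
  have chi_hat: "fps_const (chi_hat (z ^ j)) = (1 - (c ^ j) ^ 4) * G (c ^ j)" for j
    by (simp add: chi_hat_def G_def c_def fps_const_power numeral_fps_const flip: fps_const_add fps_const_sub fps_const_mult)
  have section5_const: "section5 0 (fps_const x * f) = fps_const x * section5 0 f" for x :: complex and f
    by (simp add: section5_def fps_eq_iff)
  have "10 * section5 0 NB_gf = section5 0 (10 * NB_gf)"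
    using section5_const[of 10] by (simp add: numeral_fps_const)
  also have "\<dots> = (\<Sum>j\<in>{1, 2, 3, 4}. (1 - (c ^ j) ^ 4) * G (c ^ j) * H j)"
    unfolding NB_gf_eq[OF z] by (simp only: section5_sum section5_const H_def flip: chi_hat)
  finally have "10 * section5 0 NB_gf * (2 * N ^ 2 * e)
     = (\<Sum>j\<in>{1, 2, 3, 4}. (1 - (c ^ j) ^ 4) * G (c ^ j) * H j) * (2 * N ^ 2 * e)"
    by simp
  also have "\<dots> = (1 - (c ^ 1) ^ 4) * G (c ^ 1) * H 1 * (2 * N ^ 2 * e) + (1 - (c ^ 2) ^ 4) * G (c ^ 2) * H 2 * (2 * N ^ 2 * e)
     + (1 - (c ^ 3) ^ 4) * G (c ^ 3) * H 3 * (2 * N ^ 2 * e) + (1 - (c ^ 4) ^ 4) * G (c ^ 4) * H 4 * (2 * N ^ 2 * e)"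
    by (simp only: sum_1234 distrib_right)
  also have "(1 - (c ^ 1) ^ 4) * G (c ^ 1) * H 1 * (2 * N ^ 2 * e) = theta_b ^ 4 * (M k' ^ 2 * (G c * phi c p r e))"
  proof -
    have "(1 - (c ^ 1) ^ 4) * G (c ^ 1) * H 1 * (2 * N ^ 2 * e)
      = M k' ^ 2 * G c * (2 * (1 - (c ^ 1) ^ 4) * M ((c ^ 1) ^ 2 + (c ^ 1) ^ 3) ^ 2 * H 1 * e)"
      unfolding N[symmetric] k_def power_one_right by (simp only: power_mult_distrib mult_ac)
    also have "\<dots> = M k' ^ 2 * G c * (theta_b ^ 4 * phi (c ^ 1) p r e)"
      by (subst H) (use z in simp_all)
    finally show ?thesis by (simp only: power_one_right mult_ac)
  qed
  also have "(1 - (c ^ 2) ^ 4) * G (c ^ 2) * H 2 * (2 * N ^ 2 * e)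
     = theta_b ^ 4 * (M k ^ 2 * (G (c ^ 2) * phi (c ^ 2) p r e))"
  proof -
    have k': "k' = (c ^ 2) ^ 2 + (c ^ 2) ^ 3"
      using c unfolding k'_def by algebra
    have "(1 - (c ^ 2) ^ 4) * G (c ^ 2) * H 2 * (2 * N ^ 2 * e)
      = M k ^ 2 * G (c ^ 2) * (2 * (1 - (c ^ 2) ^ 4) * M k' ^ 2 * H 2 * e)"
      unfolding N[symmetric] by (simp only: power_mult_distrib mult_ac)
    also have "\<dots> = M k ^ 2 * G (c ^ 2) * (theta_b ^ 4 * phi (c ^ 2) p r e)"
      unfolding k' by (subst H[OF cyclotomic5_conj(1)[OF z]]) (rule refl)
    finally show ?thesis by (simp only: mult_ac)
  qed
  also have "(1 - (c ^ 3) ^ 4) * G (c ^ 3) * H 3 * (2 * N ^ 2 * e)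
     = theta_b ^ 4 * (M k ^ 2 * (G (c ^ 3) * phi (c ^ 3) p r e))"
  proof -
    have k': "k' = (c ^ 3) ^ 2 + (c ^ 3) ^ 3"
      using c unfolding k'_def by algebra
    have "(1 - (c ^ 3) ^ 4) * G (c ^ 3) * H 3 * (2 * N ^ 2 * e)
      = M k ^ 2 * G (c ^ 3) * (2 * (1 - (c ^ 3) ^ 4) * M k' ^ 2 * H 3 * e)"
      unfolding N[symmetric] by (simp only: power_mult_distrib mult_ac)
    also have "\<dots> = M k ^ 2 * G (c ^ 3) * (theta_b ^ 4 * phi (c ^ 3) p r e)"
      unfolding k' by (subst H[OF cyclotomic5_conj(2)[OF z]]) (rule refl)
    finally show ?thesis by (simp only: mult_ac)
  qed
  also have "(1 - (c ^ 4) ^ 4) * G (c ^ 4) * H 4 * (2 * N ^ 2 * e)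
     = theta_b ^ 4 * (M k' ^ 2 * (G (c ^ 4) * phi (c ^ 4) p r e))"
  proof -
    have k: "k = (c ^ 4) ^ 2 + (c ^ 4) ^ 3"
      using c unfolding k_def by algebra
    have "(1 - (c ^ 4) ^ 4) * G (c ^ 4) * H 4 * (2 * N ^ 2 * e)
      = M k' ^ 2 * G (c ^ 4) * (2 * (1 - (c ^ 4) ^ 4) * M k ^ 2 * H 4 * e)"
      unfolding N[symmetric] by (simp only: power_mult_distrib mult_ac)
    also have "\<dots> = M k' ^ 2 * G (c ^ 4) * (theta_b ^ 4 * phi (c ^ 4) p r e)"
      unfolding k by (subst H[OF cyclotomic5_conj(3)[OF z]]) (rule refl)
    finally show ?thesis by (simp only: mult_ac)
  qed
  finally have "10 * section5 0 NB_gf * (2 * N ^ 2 * e)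
     = theta_b ^ 4 * (M k' ^ 2 * (G c * phi c p r e + G (c ^ 4) * phi (c ^ 4) p r e)
        + M k ^ 2 * (G (c ^ 2) * phi (c ^ 2) p r e + G (c ^ 3) * phi (c ^ 3) p r e))"
    by (simp only: distrib_left add_ac)
  also have "G c * phi c p r e + G (c ^ 4) * phi (c ^ 4) p r e = 2 * psi k p r e"
  proof -
    have "G (c ^ 4) = c + 3 * c ^ 2 + c ^ 3"
      using c unfolding G_def by algebra
    then show ?thesis using phi_pair[OF c] by (simp only: G_def k_def)
  qed
  also have "G (c ^ 2) * phi (c ^ 2) p r e + G (c ^ 3) * phi (c ^ 3) p r e = 2 * psi k' p r e"
  proof -
    have c2: "(c ^ 2) ^ 4 + (c ^ 2) ^ 3 + (c ^ 2) ^ 2 + c ^ 2 + 1 = 0" and "(c ^ 2) ^ 4 = c ^ 3"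
      "G (c ^ 3) = c ^ 2 + 3 * (c ^ 2) ^ 2 + (c ^ 2) ^ 3" "k' = (c ^ 2) ^ 2 + (c ^ 2) ^ 3"
      using c unfolding G_def k'_def by algebra+
    then show ?thesis using phi_pair[OF c2] by (simp only: G_def)
  qed
  also have "M k' ^ 2 * (2 * psi k p r e) + M k ^ 2 * (2 * psi k' p r e)
     = 10 * (N * (p ^ 2 + 49 * p * r + 44 * r ^ 2 - (p + 2 * r) * e))"
  proof -
    have "M k' ^ 2 * (2 * psi k p r e) + M k ^ 2 * (2 * psi k' p r e) = 2 * (M k' ^ 2 * psi k p r e + M k ^ 2 * psi k' p r e)"
      by (simp only: distrib_left mult_ac)
    then show ?thesis unfolding M_def psi_pair[OF kk'] N_def by simp
  qed
  finally have "(10 * N) * (2 * section5 0 NB_gf * N * e)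
      = (10 * N) * (theta_b ^ 4 * (p ^ 2 + 49 * p * r + 44 * r ^ 2 - (p + 2 * r) * e))"
    by (simp only: power2_eq_square mult_ac)
  moreover have "10 * N \<noteq> 0"
  proof -
    have "fps_nth (10 * N) 0 = 10"
      by (simp add: N_def p_def r_def fps_power_zeroth theta_nth_0 numeral_fps_const)
    then show ?thesis by (metis fps_zero_nth zero_neq_numeral)
  qed
  ultimately show ?thesis
    unfolding mult_cancel_left N_def by simp
qed

section \<open>Comparison with the stated right-hand side\<close>

text \<open>Connects the coefficientwise \<open>wsum\<close> with the X-adic infinite sum by which S
  is given.\<close>

lemma has_sum_wsum:
  assumes "fin_fibres I e"
  shows "((\<lambda>i. fps_const (w i) * fps_X ^ e i) has_sum wsum I w e) I"
proof (rule has_sum_fpsI)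
  fix n
  have *: "{i \<in> I. fps_nth (fps_const (w i) * fps_X ^ e i) n \<noteq> 0} \<subseteq> {i \<in> I. e i = n}"
    by (auto simp: fps_X_power_nth split: if_splits)
  have fin: "finite {i \<in> I. e i = n}"
    using assms by (simp add: fin_fibres_def)
  with * show "finite {i \<in> I. fps_nth (fps_const (w i) * fps_X ^ e i) n \<noteq> 0}"
    by (rule finite_subset)
  have "fps_nth (wsum I w e) n = (\<Sum>i | i \<in> I \<and> e i = n. fps_nth (fps_const (w i) * fps_X ^ e i) n)"
    by (simp add: wsum_nth)
  also have "\<dots> = (\<Sum>i | i \<in> I \<and> fps_nth (fps_const (w i) * fps_X ^ e i) n \<noteq> 0. fps_nth (fps_const (w i) * fps_X ^ e i) n)"
    by (rule sum.mono_neutral_right[OF fin *]) auto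
  finally show "fps_nth (wsum I w e) n
     = (\<Sum>i | i \<in> I \<and> fps_nth (fps_const (w i) * fps_X ^ e i) n \<noteq> 0. fps_nth (fps_const (w i) * fps_X ^ e i) n)" .
qed

lemma minus_one_powi_fps: "(- 1 :: complex fps) powi n = fps_const (alt n)"
proof -
  have "inverse (- 1 :: complex fps) = - 1"
    by (intro fps_inverse_unique) simp
  moreover have "even (nat n) \<longleftrightarrow> even n" if "n \<ge> 0" for n
    using that by (simp add: even_nat_iff)
  ultimately show ?thesis
    by (auto simp: power_int_def alt_def minus_one_power_iff simp flip: fps_const_neg)
qed

theorem theorem1p2:
  fixes q A B E1 E5 S :: "complex fps"
  assumes q: "q = fps_X"
    and A: "A = qpoch_infs [q, q ^ 4] (q ^ 5)"
    and B: "B = qpoch_infs [q ^ 2, q ^ 3] (q ^ 5)"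
    and E1: "E1 = qpoch_inf q q"
    and E5: "E5 = qpoch_inf (q ^ 5) (q ^ 5)"
    and S: "S = (\<Sum>\<^sub>\<infinity>n::int. (-1) powi n * of_int n * q ^ nat (n * (5 * n + 1) div 2))"
  shows "Abs_fps (\<lambda>n. of_nat (NB 3 1 5 (5 * n)) - of_nat (NB 3 4 5 (5 * n))
            + 2 * of_nat (NB 3 2 5 (5 * n)) - 2 * of_nat (NB 3 3 5 (5 * n)))
       = B * E5 / (2 * A ^ 3)
         - B * E5 ^ 2 / (2 * E1 ^ 5 * A ^ 3)
         - 5 * (B * E5 ^ 2 / (E1 ^ 6 * A ^ 2)) * S
         + 15 * q * B * E5 ^ 7 / (2 * E1 ^ 6 * A ^ 3) * (4 + 3 * q * (A ^ 5 / B ^ 5))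
         - 5 * q * E5 ^ 5 / (2 * E1 ^ 6 * B)"
proof -
  define a b where "a = theta_a" and "b = theta_b"
  have euler_fps: "E1 = euler_fps" "E5 = dilate5 euler_fps"
    by (simp_all add: E1 E5 q dilate5_euler_fps)
  have b: "b = E5 * B" and a: "a = E5 * A"
    unfolding a_def b_def theta_a_eq theta_b_eq by (simp_all add: A B E5 q)
  have ab: "a * b = E1 * E5"
    using theta_a_theta_b by (simp add: a_def b_def euler_fps)
  have nth_0: "fps_nth E1 0 = 1" "fps_nth E5 0 = 1" "fps_nth a 0 = 1" "fps_nth b 0 = 1"
    by (simp_all add: euler_fps a_def b_def theta_nth_0)
  then have AB_nth_0: "fps_nth A 0 = 1" "fps_nth B 0 = 1"
    by (simp_all add: a b)
  define i1 i5 h where "i1 = inverse E1" and "i5 = inverse E5" and "h = fps_const (1 / 2 :: complex)"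
  have i1: "E1 * i1 = 1" and i5: "E5 * i5 = 1" and h: "2 * h = 1"
    using nth_0 by (simp_all add: i1_def i5_def h_def inverse_mult_eq_1' numeral_fps_const)
  have B_eq: "B = b * i5"
    using i5 unfolding b by algebra
  have A_eq: "A = a * i5"
    using i5 unfolding a by algebra
  \<comment> \<open>Both amount to A B E5 = E1, which is \<open>ab\<close> with one E5
    cancelled.\<close>
  have "A * (b * i1) = 1" "B * (a * i1) = 1"
    using ab i1 i5 unfolding a b by algebra+
  then have inv: "inverse A = b * i1" "inverse B = a * i1"
    by (simp_all add: fps_inverse_unique)
  have inv2: "inverse 2 = h"
    using h by (simp add: fps_inverse_unique)
  \<comment> \<open>All denominators of the claim have nonzero constant term, so division is
    multiplication by the inverse.\<close>
  have divide: "f / g = f * inverse g" if "fps_nth g 0 \<noteq> 0" for f g :: "complex fps"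
    using that by (rule fps_divide_unit)
  define R where "R = B * E5 / (2 * A ^ 3)
         - B * E5 ^ 2 / (2 * E1 ^ 5 * A ^ 3)
         - 5 * (B * E5 ^ 2 / (E1 ^ 6 * A ^ 2)) * S
         + 15 * q * B * E5 ^ 7 / (2 * E1 ^ 6 * A ^ 3) * (4 + 3 * q * (A ^ 5 / B ^ 5))
         - 5 * q * E5 ^ 5 / (2 * E1 ^ 6 * B)"
  have R: "R = b * i5 * E5 * h * (b * i1) ^ 3
         - b * i5 * E5 ^ 2 * (h * i1 ^ 5 * (b * i1) ^ 3)
         - 5 * (b * i5 * E5 ^ 2 * (i1 ^ 6 * (b * i1) ^ 2)) * S
         + 15 * q * (b * i5) * E5 ^ 7 * (h * i1 ^ 6 * (b * i1) ^ 3) * (4 + 3 * q * ((a * i5) ^ 5 * (a * i1) ^ 5))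
         - 5 * q * E5 ^ 5 * (h * i1 ^ 6 * (a * i1))"
  proof -
    have "x / (2 * A ^ 3) = x * (h * (b * i1) ^ 3)" "x / (2 * E1 ^ 5 * A ^ 3) = x * (h * i1 ^ 5 * (b * i1) ^ 3)"
      "x / (E1 ^ 6 * A ^ 2) = x * (i1 ^ 6 * (b * i1) ^ 2)" "x / (2 * E1 ^ 6 * A ^ 3) = x * (h * i1 ^ 6 * (b * i1) ^ 3)"
      "x / B ^ 5 = x * (a * i1) ^ 5" "x / (2 * E1 ^ 6 * B) = x * (h * i1 ^ 6 * (a * i1))" for x
      by (subst divide; simp add: AB_nth_0 nth_0 fps_power_zeroth fps_inverse_mult fps_inverse_power inv inv2 i1_def)+
    then show ?thesis
      unfolding R_def by (simp only: B_eq A_eq mult.assoc)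
  qed
  have S_eq: "S = theta_b'"
  proof -
    have "fin_fibres UNIV exp_b"
    proof (rule fin_fibresI_abs)
      show "nat \<bar>k\<bar> - 1 \<le> exp_b k" for k
        using tri_ge[of k] by (simp add: exp_b_eq)
    qed
    then have "((\<lambda>n. fps_const (alt n * of_int n) * fps_X ^ exp_b n) has_sum theta_b') UNIV"
      by (rule has_sum_wsum)
    also have "(\<lambda>n. fps_const (alt n * of_int n) * fps_X ^ exp_b n)
      = (\<lambda>n. (- 1) powi n * of_int n * fps_X ^ nat (n * (5 * n + 1) div 2) :: complex fps)"
      by (simp add: minus_one_powi_fps exp_b_def fps_of_int fun_eq_iff flip: fps_const_mult)
    finally show ?thesis
      unfolding S q by (rule infsumI)
  qed
  define p r e where "p = b ^ 5" and "r = fps_X * a ^ 5" and "e = E1 ^ 3"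
  have Se: "10 * S * e = b * (p - 3 * r - e)"
    using theta_b'_eq unfolding S_eq p_def r_def e_def euler_fps a_def b_def by algebra
  define N where "N = p ^ 2 - 11 * p * r - r ^ 2"
  have N: "N * E5 = E1 ^ 11"
    using euler_fps_eleventh by (simp add: N_def p_def r_def euler_fps a_def b_def power_mult_distrib mult_ac flip: power_mult)
  have N': "N = E1 ^ 11 * i5"
    using N i5 by algebra
  \<comment> \<open>The relation of \<open>section5_NB_gf\<close>, now for the stated right-hand
    side. Since N e = E1^14 / E5, each of its five terms becomes b^4 times a polynomial in p, r and
    e.\<close>
  have "2 * R * N * e = b ^ 4 * (p ^ 2 + 49 * p * r + 44 * r ^ 2 - (p + 2 * r) * e)"
  proof -
    define m Z where "m = (E1 ^ 11 * i5) * E1 ^ 3" and "Z = (a * i5) ^ 5 * (a * i1) ^ 5"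
    have "2 * (b * i5 * E5 * h * (b * i1) ^ 3) * m = (2 * h) * (E5 * i5) * (E1 * i1) ^ 3 * (b ^ 4 * (E1 ^ 11 * i5))"
      by (simp add: m_def eval_nat_numeral mult_ac)
    then have t1: "2 * (b * i5 * E5 * h * (b * i1) ^ 3) * m = b ^ 4 * N"
      by (simp only: h i1 i5 N' power_one mult_1)
    have "2 * (b * i5 * E5 ^ 2 * (h * i1 ^ 5 * (b * i1) ^ 3)) * m = (2 * h) * (E5 * i5) ^ 2 * (E1 * i1) ^ 8 * (b ^ 4 * (e * e))"
      by (simp add: m_def e_def eval_nat_numeral mult_ac)
    then have t2: "2 * (b * i5 * E5 ^ 2 * (h * i1 ^ 5 * (b * i1) ^ 3)) * m = b ^ 4 * (e * e)"
      by (simp only: h i1 i5 power_one mult_1)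
    have "2 * (5 * (b * i5 * E5 ^ 2 * (i1 ^ 6 * (b * i1) ^ 2)) * S) * m
      = (E5 * i5) ^ 2 * (E1 * i1) ^ 8 * (b ^ 3 * e * (2 * 5 * S * e))"
      by (simp add: m_def e_def eval_nat_numeral mult_ac)
    also have "2 * 5 * S * e = b * (p - 3 * r - e)"
      using Se by simp
    finally have t3: "2 * (5 * (b * i5 * E5 ^ 2 * (i1 ^ 6 * (b * i1) ^ 2)) * S) * m = b ^ 4 * (e * (p - 3 * r - e))"
      by (simp add: i1 i5 eval_nat_numeral mult_ac)
    have ab5: "E5 ^ 5 * E1 ^ 5 = a ^ 5 * b ^ 5"
      using ab by (metis mult.commute power_mult_distrib)
    have "E5 ^ 5 * E1 ^ 5 * Z = (E5 * i5) ^ 5 * (E1 * i1) ^ 5 * (a ^ 5 * a ^ 5)"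
      unfolding Z_def power_mult_distrib by (simp only: mult_ac)
    then have Z: "E5 ^ 5 * E1 ^ 5 * Z = a ^ 5 * a ^ 5"
      by (simp only: i1 i5 power_one mult_1)
    have "2 * (15 * q * (b * i5) * E5 ^ 7 * (h * i1 ^ 6 * (b * i1) ^ 3) * (4 + 3 * q * Z)) * m
      = (2 * h) * (E5 * i5) ^ 2 * (E1 * i1) ^ 9 * (15 * q * b ^ 4 * (E5 ^ 5 * E1 ^ 5) * (4 + 3 * q * Z))"
      by (simp add: m_def eval_nat_numeral mult_ac)
    also have "\<dots> = 60 * q * b ^ 4 * (E5 ^ 5 * E1 ^ 5) + 45 * q ^ 2 * b ^ 4 * (E5 ^ 5 * E1 ^ 5 * Z)"
      unfolding h i1 i5 by (simp add: algebra_simps power2_eq_square)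
    finally have t4: "2 * (15 * q * (b * i5) * E5 ^ 7 * (h * i1 ^ 6 * (b * i1) ^ 3) * (4 + 3 * q * Z)) * m
      = b ^ 4 * (60 * p * r + 45 * r ^ 2)"
      unfolding Z unfolding ab5 by (simp add: p_def r_def q algebra_simps power2_eq_square)
    have "2 * (5 * q * E5 ^ 5 * (h * i1 ^ 6 * (a * i1))) * m
      = (2 * h) * (E5 * i5) * (E1 * i1) ^ 7 * (5 * q * (E1 * E5) ^ 4 * a * e)"
      by (simp add: m_def e_def eval_nat_numeral mult_ac)
    then have t5: "2 * (5 * q * E5 ^ 5 * (h * i1 ^ 6 * (a * i1))) * m = b ^ 4 * (5 * r * e)"
      by (simp only: h i1 i5 power_one mult_1 ab[symmetric]) (simp add: r_def q eval_nat_numeral mult_ac)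
    have "2 * R * N * e = 2 * R * m"
      by (simp only: N' e_def m_def mult.assoc)
    also have "\<dots> = b ^ 4 * N - b ^ 4 * (e * e) - b ^ 4 * (e * (p - 3 * r - e)) + b ^ 4 * (60 * p * r + 45 * r ^ 2) - b ^ 4 * (5 * r * e)"
      unfolding t1[symmetric] t2[symmetric] t3[symmetric] t4[symmetric] t5[symmetric] R Z_def[symmetric]
      by (simp only: right_diff_distrib[of 2] distrib_left[of 2] left_diff_distrib[of _ _ m] distrib_right[of _ _ m])
    \<comment> \<open>The squares of e cancel; 49 = 60 - 11, 44 = 45 - 1 and 2 = 5 - 3.\<close>
    also have "\<dots> = b ^ 4 * (p ^ 2 + 49 * p * r + 44 * r ^ 2 - (p + 2 * r) * e)"
      by (simp add: N_def algebra_simps)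
    finally show ?thesis .
  qed
  also have "\<dots> = 2 * section5 0 NB_gf * N * e"
    using section5_NB_gf by (simp only: N_def p_def r_def e_def euler_fps a_def b_def)
  finally have "R * (2 * N * e) = section5 0 NB_gf * (2 * N * e)"
    by (simp only: mult_ac)
  moreover have "2 * N * e \<noteq> 0"
  proof -
    have "fps_nth (2 * N * e) 0 = 2"
      by (simp add: N_def p_def r_def e_def nth_0 fps_power_zeroth numeral_fps_const)
    then show ?thesis by (metis fps_zero_nth zero_neq_numeral)
  qed
  ultimately have "section5 0 NB_gf = R"
    by simp
  then show ?thesis
    unfolding R_def section5_def by simp
qed

end
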